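(* Fix an integer $k\ge1$. For $N>k$, consider the colored loop-erased walk from $N$ stopped on first hitting $[k]$, let $\lambda_{N,k}$ be its length, $\nu_{N,k}$ its number of colors, $(\sigma_{N,k,1},\ldots,\sigma_{N,k,\nu_{N,k}})$ the numbers of edges of each color in order along the path from $N$ to $[k]$, and let $$(\sigma'_{N,k,1},\ldots,\sigma'_{N,k,\nu_{N,k}}):=(\sigma_{N,k,\nu_{N,k}},\ldots,\sigma_{N,k,1})$$ be the reversed sequence. Then, as $N\to\infty$, $$\lambda_{N,k}^{-1}\left(\sigma'_{N,k,1},\ldots,\sigma'_{N,k,\nu_{N,k}}\right)\ \longrightarrow\ \left(U_1,(1-U_1)U_2,(1-U_1)(1-U_2)U_3,\ldots\right)$$ in distribution, where $U_1,U_2,\ldots$ are independent random variables uniformly distributed on $(0,1)$, the finite sequence on the left is extended by infinitely many zeros, and convergence in distribution means convergence of all finite-dimensional distributions.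
   Context: Notation: $[m]=\{1,\ldots,m\}$. The walk: for integers $N\ge2$, $1\le k\le N-1$, let $X_0=N$ and $X_1,X_2,\ldots$ be independent and uniform on $[N]$; $\zeta_{N,k}$ is the first time $t$ with $X_t\in[k]$. Loop-erased walk: define finite sequences $\mathcal{L}_n=(Y_{n,0},\ldots,Y_{n,L_n})$ inductively. Set $\mathcal{L}_0=(X_0)$, $L_0=0$. If $X_n$ is not among the terms of $\mathcal{L}_{n-1}$, append $X_n$ to $\mathcal{L}_{n-1}$ to get $\mathcal{L}_n$, so $L_n=L_{n-1}+1$. If $X_n=Y_{n-1,j}$ for some $0\le j\le L_{n-1}$, then $\mathcal{L}_n=(Y_{n-1,0},\ldots,Y_{n-1,j})$ and $L_n=j$; in this case a loop is said to occur at time $n$ (including the case $X_n=X_{n-1}$). The $i$-th edge at time $n$ is $(Y_{n,i-1},Y_{n,i})$, $1\le i\le L_n$. Coloring: there is an infinite palette of distinct colors. Every edge appended is painted with the current color; each time a loop occurs, edges beyond the truncation point are erased, remaining edges keep their colors, and the current color changes to a brand new one. Then $\lambda_{N,k}=L_{\zeta_{N,k}}$ is the number of edges of $\mathcal{L}_{\zeta_{N,k}}$ and $\nu_{N,k}$ is the number of different colors among those edges (edges of the same color are consecutive). *)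

theory Defs
  imports "HOL-Probability.Probability"
begin

text \<open>
  The walk on $[N]$ started at $N$: deterministic at time 0, afterwards independent and uniform.
\<close>

definition uniform_walk :: "'a measure \<Rightarrow> nat \<Rightarrow> (nat \<Rightarrow> 'a \<Rightarrow> nat) \<Rightarrow> bool" where
  "uniform_walk M N X \<longleftrightarrow>
     prob_space M \<and>
     (\<forall>\<omega>\<in>space M. X 0 \<omega> = N) \<and>
     prob_space.indep_vars M (\<lambda>_. count_space UNIV) X {1..} \<and>
     (\<forall>t\<ge>1. distr M (count_space UNIV) (X t) = measure_pmf (pmf_of_set {1..N}))"

text \<open>
  If the trajectory \<open>x\<close> never visits $[k]$ (a null event for the walk), the value is arbitrary.
\<close>

definition hitting_time :: "nat \<Rightarrow> (nat \<Rightarrow> nat) \<Rightarrow> nat" where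
  "hitting_time k x = (LEAST t. x t \<in> {1..k})"

text \<open>
  A state \<open>(ys, cs, c)\<close> consists of the vertices $Y_0,\ldots,Y_L$ of the loop-erased path,
  the colors of its $L$ edges (\<open>cs ! i\<close> is the color of the edge from \<open>ys ! i\<close> to
  \<open>ys ! Suc i\<close>), and the current color. Colors are natural numbers; since the current color only
  ever increases, \<open>Suc c\<close> is a color that has never been used before.
\<close>

type_synonym colored_path = "nat list \<times> nat list \<times> nat"

fun lerw_step :: "nat \<Rightarrow> colored_path \<Rightarrow> colored_path" where
  "lerw_step v (ys, cs, c) =
     (if v \<in> set ys
      then let zs = takeWhile (\<lambda>y. y \<noteq> v) ys in (zs @ [v], take (length zs) cs, Suc c)
      else (ys @ [v], cs @ [c], c))"

primrec lerw :: "(nat \<Rightarrow> nat) \<Rightarrow> nat \<Rightarrow> colored_path" where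
  "lerw x 0 = ([x 0], [], 0)"
| "lerw x (Suc n) = lerw_step (x (Suc n)) (lerw x n)"

definition edge_colors :: "nat \<Rightarrow> (nat \<Rightarrow> nat) \<Rightarrow> nat list" where
  "edge_colors k x = fst (snd (lerw x (hitting_time k x)))"

definition path_length :: "nat \<Rightarrow> (nat \<Rightarrow> nat) \<Rightarrow> nat" where
  "path_length k x = length (edge_colors k x)"

definition num_colors :: "nat \<Rightarrow> (nat \<Rightarrow> nat) \<Rightarrow> nat" where
  "num_colors k x = card (set (edge_colors k x))"

text \<open>
  Edges of the same color are consecutive, so \<open>remdups\<close> lists the colors in their order along
  the path, and the list below has length \<^term>\<open>num_colors k x\<close>.
\<close>

definition color_counts :: "nat \<Rightarrow> (nat \<Rightarrow> nat) \<Rightarrow> nat list" where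
  "color_counts k x =
     (let cs = edge_colors k x in map (\<lambda>c. count_list cs c) (remdups cs))"

text \<open>Entry \<open>i\<close> is $\sigma'_{i+1} / \lambda$, extended by zeros.\<close>

definition reversed_proportions :: "nat \<Rightarrow> (nat \<Rightarrow> nat) \<Rightarrow> nat \<Rightarrow> real" where
  "reversed_proportions k x i =
     (if i < num_colors k x
      then real (rev (color_counts k x) ! i) / real (path_length k x) else 0)"

text \<open>The limit sequence, with \<open>u i\<close> in the role of $U_{i+1}$.\<close>

definition stick_breaking :: "(nat \<Rightarrow> real) \<Rightarrow> nat \<Rightarrow> real" where
  "stick_breaking u i = (\<Prod>j<i. 1 - u j) * u i"

text \<open>
  Convergence of all finite-dimensional distributions of random sequences, possibly living on
  different probability spaces: for each finite index set \<open>J\<close>, weak convergence of the laws on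
  $\mathbf{R}^J$ (functions restricted to \<open>J\<close>, with the product topology), i.e. convergence of
  the expectations of all bounded continuous functions.
\<close>

definition fdd_converges ::
  "(nat \<Rightarrow> 'a measure) \<Rightarrow> (nat \<Rightarrow> 'a \<Rightarrow> nat \<Rightarrow> real) \<Rightarrow> 'b measure \<Rightarrow> ('b \<Rightarrow> nat \<Rightarrow> real) \<Rightarrow> bool"
  where
  "fdd_converges M Z P W \<longleftrightarrow>
     (\<forall>J f. finite J \<and> continuous_map (powertop_real J) euclideanreal f \<and>
            bounded (f ` topspace (powertop_real J)) \<longrightarrow>
        (\<lambda>N. LINT \<omega>|M N. f (restrict (Z N \<omega>) J)) \<longlonglongrightarrow> (LINT \<omega>|P. f (restrict (W \<omega>) J)))"

end

theory Submission
  imports Defs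
begin

text \<open>
  The law of the color blocks can be computed exactly for every $N$, not only in the limit.

  Just before the walk hits $[k]$, record for each vertex of the current path whether the color
  changes at that vertex. (The starting vertex always counts as a change, and the last vertex
  counts if the current color is still fresh; the edge into $[k]$ then has the current color.) This
  pattern of marks is itself a Markov chain: from a path with $n$ vertices it gains an unmarked
  position with probability $(N-k-n)/N$, is cut back to its first $j$ positions and followed by one
  marked position with probability $1/N$ for each $j<n$, and is stopped with probability $k/N$. Its
  expected occupation measure solves a linear balance equation, and the solution has product form:
  given the length $n$, position $j\ge1$ is marked with probability $1/(j+1+k)$, independently over
  $j$ (\<open>occupation_balance\<close>). The solution is unique because the
  chain dies at the constant rate $k/N$, so the balance equation can be iterated until the remainder
  vanishes. Hence (\<open>expectation_final\<close>), conditionally on $\lambda_{N,k}=n$,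
  the marks are independent with these probabilities; they do not depend on $N$.

  For such marks, the part of the path below the last mark has length $\max(0,I-k)$ with $I$ uniform
  on $\{0,\ldots,n+k-1\}$, and the marks inside that part have the same product law
  (\<open>mark_mean_drop_block\<close>). So the reversed block lengths come from a discrete
  stick-breaking, which can be run on the probability space of the $U_i$ by taking
  $I=\lfloor(n+k)(1-U_i)\rfloor$ (\<open>expectation_stick\<close>). Under this coupling the
  normalized blocks converge almost surely to the continuous stick-breaking as $n\to\infty$
  (\<open>stick_left_LIMSEQ\<close>). Finally the length $\lambda_{N,k}$ tends to infinity,
  because $P(\lambda_{N,k}=n)\le(n+k)/N$ (\<open>survival_average_LIMSEQ\<close>).
\<close>

section \<open>Independent marks\<close>

text \<open>
  Expectation of \<open>\<phi>\<close> over random patterns of \<open>n\<close> independent marks. The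
  list is in reverse order: its head belongs to the last position of the path, so extending the path
  is consing, cutting it back is \<^term>\<open>drop\<close>, and the first color block to be read off
  is the one nearest to $[k]$.
\<close>

primrec mark_mean :: "nat \<Rightarrow> nat \<Rightarrow> (bool list \<Rightarrow> real) \<Rightarrow> real" where
  "mark_mean k 0 \<phi> = \<phi> []"
| "mark_mean k (Suc n) \<phi> =
     (let q = if n = 0 then 1 else 1 / real (n + 1 + k)
      in q * mark_mean k n (\<lambda>bs. \<phi> (True # bs)) + (1 - q) * mark_mean k n (\<lambda>bs. \<phi> (False # bs)))"

lemma mark_mean_Suc:
  assumes "n \<ge> 1"
  shows "real (Suc n + k) * mark_mean k (Suc n) \<phi> =
    mark_mean k n (\<lambda>bs. \<phi> (True # bs)) + real (n + k) * mark_mean k n (\<lambda>bs. \<phi> (False # bs))"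
proof -
  have "c * (1 / c * x + (1 - 1 / c) * y) = x + (c - 1) * y" if "c > 0" for c x y :: real
    using that by (simp add: field_simps)
  from this[of "real (Suc n + k)"] show ?thesis using assms by (simp add: Let_def)
qed

lemma mark_mean_cong:
  assumes "\<And>bs. length bs = n \<Longrightarrow> \<phi> bs = \<phi>' bs"
  shows "mark_mean k n \<phi> = mark_mean k n \<phi>'"
  using assms
proof (induction n arbitrary: \<phi> \<phi>')
  case (Suc n)
  have "mark_mean k n (\<lambda>bs. \<phi> (b # bs)) = mark_mean k n (\<lambda>bs. \<phi>' (b # bs))" for b
    by (rule Suc.IH) (simp add: Suc.prems)
  then show ?case by simp
qed simp

lemma mark_mean_const: "mark_mean k n (\<lambda>_. c) = c"
  by (induction n) (simp_all add: Let_def algebra_simps)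

lemma mark_mean_add: "mark_mean k n (\<lambda>bs. \<phi> bs + \<phi>' bs) = mark_mean k n \<phi> + mark_mean k n \<phi>'"
  by (induction n arbitrary: \<phi> \<phi>') (simp_all add: Let_def algebra_simps)

lemma mark_mean_scale: "mark_mean k n (\<lambda>bs. c * \<phi> bs) = c * mark_mean k n \<phi>"
  by (induction n arbitrary: \<phi>) (simp_all add: Let_def algebra_simps)

lemma mark_mean_sum:
  "finite A \<Longrightarrow> mark_mean k n (\<lambda>bs. \<Sum>j\<in>A. \<phi> j bs) = (\<Sum>j\<in>A. mark_mean k n (\<phi> j))"
  by (induction A rule: finite_induct) (simp_all add: mark_mean_const mark_mean_add)

lemma mark_mean_mono:
  assumes "\<And>bs. length bs = n \<Longrightarrow> \<phi> bs \<le> \<phi>' bs"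
  shows "mark_mean k n \<phi> \<le> mark_mean k n \<phi>'"
  using assms
proof (induction n arbitrary: \<phi> \<phi>')
  case (Suc n)
  have "mark_mean k n (\<lambda>bs. \<phi> (b # bs)) \<le> mark_mean k n (\<lambda>bs. \<phi>' (b # bs))" for b
    by (rule Suc.IH) (simp add: Suc.prems)
  then show ?case
    by (auto simp: Let_def intro!: add_mono mult_left_mono divide_right_mono)
qed simp

lemma mark_mean_abs_le:
  assumes "\<And>bs. length bs = n \<Longrightarrow> \<bar>\<phi> bs\<bar> \<le> B"
  shows "\<bar>mark_mean k n \<phi>\<bar> \<le> B"
proof -
  have "mark_mean k n \<phi> \<le> mark_mean k n (\<lambda>_. B)"
    by (rule mark_mean_mono) (use assms in \<open>fastforce simp: abs_le_iff\<close>)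
  moreover have "mark_mean k n (\<lambda>_. - B) \<le> mark_mean k n \<phi>"
    by (rule mark_mean_mono) (use assms in \<open>fastforce simp: abs_le_iff\<close>)
  ultimately show ?thesis by (simp add: mark_mean_const)
qed

text \<open>
  Independence of the marks: the positions that a loop cuts away carry no information on those that
  stay, whatever the length before the loop.
\<close>

lemma mark_mean_drop:
  "mark_mean k (m + j) (\<lambda>bs. \<phi> (drop m bs)) = mark_mean k j \<phi>"
  by (induction m) (simp_all add: Let_def algebra_simps)

definition drop_block :: "bool list \<Rightarrow> bool list" where
  "drop_block bs = tl (dropWhile Not bs)"

lemma drop_block_simps [simp]:
  "drop_block [] = []" "drop_block (True # bs) = bs" "drop_block (False # bs) = drop_block bs"
  by (simp_all add: drop_block_def)

text \<open>
  The position of the last mark is uniform up to an atom at \<open>0\<close>: it is at \<open>r\<close>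
  with probability $\frac1{r+1+k}\prod_{j=r+1}^{n-1}\frac{j+k}{j+1+k}=\frac1{n+k}$ for $1\le r<n$,
  and the remaining mass $(k+1)/(n+k)$ sits at \<open>0\<close>. Truncated subtraction
  produces exactly this atom, from the \<open>k + 1\<close> indices \<open>i \<le> k\<close>.
\<close>

lemma mark_mean_drop_block:
  "real (n + k) * mark_mean k n (\<lambda>bs. \<phi> (drop_block bs)) = (\<Sum>i<n + k. mark_mean k (i - k) \<phi>)"
proof (induction n)
  case 0
  then show ?case by simp
next
  case (Suc n)
  show ?case
  proof (cases "n = 0")
    case True
    then show ?thesis by (simp add: algebra_simps)
  next
    case False
    have "real (Suc n + k) * mark_mean k (Suc n) (\<lambda>bs. \<phi> (drop_block bs)) =
        mark_mean k n \<phi> + real (n + k) * mark_mean k n (\<lambda>bs. \<phi> (drop_block bs))"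
      using False mark_mean_Suc[of n k "\<lambda>bs. \<phi> (drop_block bs)"] by simp
    with Suc.IH show ?thesis by simp
  qed
qed

section \<open>The occupation measure of the mark pattern\<close>

text \<open>
  Probability that a path of one vertex grows to \<open>n\<close> vertices without a loop or a hit.
  By \<open>survival_diff\<close> and \<open>expectation_final\<close> it is also the probability
  that the loop-erased path has at least \<open>n\<close> vertices just before the hit, as if every
  loop ended the walk as well.
\<close>

definition survival :: "nat \<Rightarrow> nat \<Rightarrow> nat \<Rightarrow> real" where
  "survival N k n = (\<Prod>i=1..<n. (real N - real k - real i) / real N)"

text \<open>
  One step of the mark pattern restricted to survival. A loop that leaves \<open>j\<close> edges
  keeps the first \<open>j\<close> marks and marks the new end of the path, since the next edge gets a
  new color.
\<close>

definition shape_kernel :: "nat \<Rightarrow> nat \<Rightarrow> (bool list \<Rightarrow> real) \<Rightarrow> bool list \<Rightarrow> real" where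
  "shape_kernel N k \<phi> bs =
     ((real N - real k - real (length bs)) * \<phi> (False # bs) +
      (\<Sum>j<length bs. \<phi> (True # drop (length bs - j) bs))) / real N"

text \<open>
  The product-form candidate for the expected total of \<open>\<phi>\<close> over the patterns seen before
  hitting $[k]$. The factor $1/k$ is forced by the balance at the pattern of length one.
\<close>

definition occupation :: "nat \<Rightarrow> nat \<Rightarrow> (bool list \<Rightarrow> real) \<Rightarrow> real" where
  "occupation N k \<phi> = (\<Sum>n=1..N - k. survival N k n * real (n + k) / real k * mark_mean k n \<phi>)"

lemma survival_1: "survival N k (Suc 0) = 1"
  by (simp add: survival_def)

lemma survival_Suc:
  "n \<ge> 1 \<Longrightarrow> survival N k (Suc n) = survival N k n * ((real N - real k - real n) / real N)"
  by (simp add: survival_def prod.atLeastLessThan_Suc)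

lemma survival_diff:
  assumes "n \<ge> 1" "N > 0"
  shows "survival N k n * real (n + k) / real N = survival N k n - survival N k (Suc n)"
  using assms by (simp add: survival_Suc field_simps)

lemma survival_end:
  assumes "N > k"
  shows "survival N k (Suc (N - k)) = 0"
  using assms by (simp add: survival_Suc)

lemma survival_bounds:
  assumes "N > k" "n \<le> Suc (N - k)"
  shows "0 \<le> survival N k n" "survival N k n \<le> 1"
  unfolding survival_def using assms
  by (auto intro!: prod_nonneg prod_le_1)

lemma survival_telescope:
  assumes "N > k" "1 \<le> j" "j \<le> Suc (N - k)"
  shows "(\<Sum>n=j..N - k. survival N k n * real (n + k) / real N) = survival N k j"
proof -
  have "(\<Sum>n=j..N - k. survival N k n * real (n + k) / real N) =
      (\<Sum>n=j..N - k. survival N k n - survival N k (Suc n))"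
    using assms by (intro sum.cong refl survival_diff) auto
  also have "\<dots> = survival N k j - survival N k (Suc (N - k))"
    using assms(3)
    by (metis (no_types, lifting) sum.cong sum_Suc_diff sum_negf minus_diff_eq)
  finally show ?thesis using assms by (simp add: survival_end)
qed

lemma mark_mean_shape_kernel:
  assumes "N > 0"
  shows "mark_mean k n (shape_kernel N k \<phi>) =
    ((real N - real k - real n) * mark_mean k n (\<lambda>bs. \<phi> (False # bs)) +
     (\<Sum>j<n. mark_mean k j (\<lambda>bs. \<phi> (True # bs)))) / real N"
proof -
  have "mark_mean k n (shape_kernel N k \<phi>) =
    mark_mean k n (\<lambda>bs. 1 / real N * ((real N - real k - real n) * \<phi> (False # bs) +
     (\<Sum>j<n. \<phi> (True # drop (n - j) bs))))"
    by (rule mark_mean_cong) (simp add: shape_kernel_def)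
  also have "\<dots> = 1 / real N * ((real N - real k - real n) * mark_mean k n (\<lambda>bs. \<phi> (False # bs)) +
     (\<Sum>j<n. mark_mean k n (\<lambda>bs. \<phi> (True # drop (n - j) bs))))"
    by (simp only: mark_mean_scale mark_mean_add mark_mean_sum finite_lessThan)
  also have "(\<Sum>j<n. mark_mean k n (\<lambda>bs. \<phi> (True # drop (n - j) bs))) =
      (\<Sum>j<n. mark_mean k j (\<lambda>bs. \<phi> (True # bs)))"
  proof (rule sum.cong)
    fix j assume "j \<in> {..<n}"
    then show "mark_mean k n (\<lambda>bs. \<phi> (True # drop (n - j) bs)) = mark_mean k j (\<lambda>bs. \<phi> (True # bs))"
      using mark_mean_drop[of k "n - j" j "\<lambda>bs. \<phi> (True # bs)"] by simp
  qed simp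
  finally show ?thesis by simp
qed

text \<open>
  Patterns whose head is unmarked come from extensions, and there the weights match by the recursion
  for \<^const>\<open>survival\<close>. A pattern of length \<open>j + 1\<close> with marked head comes
  from loops at any length \<open>n > j\<close>; by \<open>mark_mean_drop\<close> each length contributes
  the same pattern law, and the total weight telescopes to \<open>survival N k (Suc j)\<close>.
\<close>

lemma occupation_balance:
  assumes "k \<ge> 1" "N > k"
  shows "occupation N k \<phi> = \<phi> [True] + occupation N k (shape_kernel N k \<phi>)"
proof -
  let ?s = "survival N k"
  let ?F = "\<lambda>n. mark_mean k n (\<lambda>bs. \<phi> (False # bs))"
  let ?T = "\<lambda>n. mark_mean k n (\<lambda>bs. \<phi> (True # bs))"
  have "real k * occupation N k (shape_kernel N k \<phi>) =
      (\<Sum>n=1..N - k. ?s n * real (n + k) * mark_mean k n (shape_kernel N k \<phi>))"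
    using assms by (simp add: occupation_def sum_distrib_left)
  also have "\<dots> = (\<Sum>n=1..N - k. ?s (Suc n) * real (n + k) * ?F n) +
      (\<Sum>n=1..N - k. \<Sum>j<n. ?s n * real (n + k) / real N * ?T j)"
    unfolding sum.distrib[symmetric] sum_distrib_left[symmetric]
    using assms
    by (intro sum.cong refl)
      (simp add: mark_mean_shape_kernel survival_Suc add_divide_distrib distrib_left distrib_right mult_ac)
  \<comment> \<open>Sum over the length before the loop first, for a fixed length after it.\<close>
  also have "(\<Sum>n=1..N - k. \<Sum>j<n. ?s n * real (n + k) / real N * ?T j) =
      (\<Sum>j<N - k. \<Sum>n=Suc j..N - k. ?s n * real (n + k) / real N * ?T j)"
    unfolding sum.Sigma[OF finite_atLeastAtMost, OF ballI[OF finite_lessThan]]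
      sum.Sigma[OF finite_lessThan, OF ballI[OF finite_atLeastAtMost]]
    by (rule sum.reindex_bij_witness[of _ prod.swap prod.swap]) auto
  also have "\<dots> = (\<Sum>j<N - k. ?s (Suc j) * ?T j)"
    unfolding sum_distrib_right[symmetric]
    using assms by (intro sum.cong refl) (subst survival_telescope, auto)
  \<comment> \<open>The added term is zero because no extension is possible at the maximal length.\<close>
  also have "\<dots> = (\<Sum>j<Suc (N - k). ?s (Suc j) * ?T j)"
    using assms by (simp add: survival_end)
  also have "\<dots> = \<phi> [True] + (\<Sum>n=1..N - k. ?s (Suc n) * ?T n)"
    by (subst sum.lessThan_Suc_shift)
      (simp add: survival_1 sum.atLeast1_atMost_eq del: mark_mean.simps(2))
  also have "(\<Sum>n=1..N - k. ?s (Suc n) * real (n + k) * ?F n) +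
      (\<phi> [True] + (\<Sum>n=1..N - k. ?s (Suc n) * ?T n)) =
      \<phi> [True] + (\<Sum>n=1..N - k. ?s (Suc n) * (real (Suc n + k) * mark_mean k (Suc n) \<phi>))"
    unfolding add.left_commute[of _ "\<phi> [True]"] sum.distrib[symmetric]
    by (intro arg_cong2[of _ _ _ _ "(+)"] refl sum.cong, subst mark_mean_Suc)
      (auto simp: algebra_simps)
  also have "(\<Sum>n=1..N - k. ?s (Suc n) * (real (Suc n + k) * mark_mean k (Suc n) \<phi>)) =
      (\<Sum>n=Suc 1..Suc (N - k). ?s n * real (n + k) * mark_mean k n \<phi>)"
    by (subst sum.shift_bounds_cl_Suc_ivl) (simp only: mult.assoc)
  also have "\<dots> = (\<Sum>n=Suc 1..N - k. ?s n * real (n + k) * mark_mean k n \<phi>)"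
    using assms by (simp add: survival_end)
  also have "\<dots> = (\<Sum>n=1..N - k. ?s n * real (n + k) * mark_mean k n \<phi>) - real (1 + k) * \<phi> [True]"
    using assms by (subst (2) sum.atLeast_Suc_atMost) (auto simp: survival_1 simp del: sum.cl_ivl_Suc)
  also have "(\<Sum>n=1..N - k. ?s n * real (n + k) * mark_mean k n \<phi>) = real k * occupation N k \<phi>"
    using assms by (simp add: occupation_def sum_distrib_left)
  finally have "real k * occupation N k (shape_kernel N k \<phi>) = real k * (occupation N k \<phi> - \<phi> [True])"
    by (simp add: algebra_simps)
  then show ?thesis using assms by simp
qed

lemma occupation_iterate:
  assumes "k \<ge> 1" "N > k"
  shows "occupation N k \<phi> =
    (\<Sum>t<T. (shape_kernel N k ^^ t) \<phi> [True]) + occupation N k ((shape_kernel N k ^^ T) \<phi>)"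
proof (induction T)
  case (Suc T)
  then show ?case
    using occupation_balance[OF assms, of "(shape_kernel N k ^^ T) \<phi>"] by simp
qed simp

text \<open>
  The kernel loses the mass $k/N$ in every step. Only lengths up to \<open>N - k\<close> occur; at length
  \<open>N - k\<close> the extension has coefficient \<open>0\<close>, so a bound over these lengths
  is passed on from step to step.
\<close>

lemma shape_kernel_abs_le:
  assumes "N > k" and \<phi>: "\<And>bs. length bs \<le> N - k \<Longrightarrow> \<bar>\<phi> bs\<bar> \<le> B"
    and bs: "length bs \<le> N - k"
  shows "\<bar>shape_kernel N k \<phi> bs\<bar> \<le> (1 - real k / real N) * B"
proof -
  let ?n = "length bs"
  have 1: "\<bar>(real N - real k - real ?n) * \<phi> (False # bs)\<bar> \<le> (real N - real k - real ?n) * B"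
  proof (cases "?n = N - k")
    case True
    then show ?thesis using assms(1) by simp
  next
    case False
    then have "\<bar>\<phi> (False # bs)\<bar> \<le> B" "real N - real k - real ?n \<ge> 0"
      using bs assms(1) by (auto intro!: \<phi>)
    then show ?thesis by (simp add: abs_mult mult_left_mono)
  qed
  have 2: "\<bar>\<Sum>j<?n. \<phi> (True # drop (?n - j) bs)\<bar> \<le> real ?n * B"
  proof -
    have "\<bar>\<Sum>j<?n. \<phi> (True # drop (?n - j) bs)\<bar> \<le> (\<Sum>j<?n. \<bar>\<phi> (True # drop (?n - j) bs)\<bar>)"
      by (rule sum_abs)
    also have "\<dots> \<le> (\<Sum>j<?n. B)"
      using bs by (intro sum_mono \<phi>) auto
    finally show ?thesis by simp
  qed
  have "\<bar>shape_kernel N k \<phi> bs\<bar> \<le> ((real N - real k - real ?n) * B + real ?n * B) / real N"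
    unfolding shape_kernel_def abs_divide using 1 2
    by (auto intro!: divide_right_mono order.trans[OF abs_triangle_ineq])
  also have "\<dots> = (1 - real k / real N) * B"
    using assms(1) by (simp add: field_simps)
  finally show ?thesis .
qed

lemma shape_kernel_iterate_abs_le:
  assumes "N > k" "\<And>bs. \<bar>\<phi> bs\<bar> \<le> B" "length bs \<le> N - k"
  shows "\<bar>(shape_kernel N k ^^ t) \<phi> bs\<bar> \<le> (1 - real k / real N) ^ t * B"
  using assms(3)
proof (induction t arbitrary: bs)
  case 0
  then show ?case using assms(2) by simp
next
  case (Suc t)
  show ?case
    using shape_kernel_abs_le[OF assms(1) Suc.IH Suc.prems] by (simp add: mult.assoc)
qed

lemma occupation_LIMSEQ:
  assumes "k \<ge> 1" "N > k" "\<And>bs. \<bar>\<phi> bs\<bar> \<le> B"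
  shows "(\<lambda>t. occupation N k ((shape_kernel N k ^^ t) \<phi>)) \<longlonglongrightarrow> 0"
proof -
  have geo: "(\<lambda>t. (1 - real k / real N) ^ t * B) \<longlonglongrightarrow> 0"
    using assms by (intro tendsto_mult_left_zero LIMSEQ_power_zero) (auto simp: field_simps)
  have "(\<lambda>t. mark_mean k n ((shape_kernel N k ^^ t) \<phi>)) \<longlonglongrightarrow> 0" if "n \<le> N - k" for n
    by (rule Lim_null_comparison[OF _ geo])
      (use that shape_kernel_iterate_abs_le[OF assms(2,3)]
        in \<open>auto intro!: always_eventually mark_mean_abs_le\<close>)
  then show ?thesis
    unfolding occupation_def by (intro tendsto_null_sum tendsto_mult_right_zero) auto
qed

section \<open>Mark patterns of colored paths\<close>

text \<open>
  The argument lists colors starting from the end of the path, as the result does. The list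
  used below is the colors of the edges together with the current color, which has one entry
  per vertex; it is also the list of edge colors at the hitting time.
\<close>

fun marks :: "nat list \<Rightarrow> bool list" where
  "marks [] = []"
| "marks (d # ds) = (ds = [] \<or> hd ds \<noteq> d) # marks ds"

lemma length_marks [simp]: "length (marks ds) = length ds"
  by (induction ds) auto

lemma drop_marks: "drop m (marks ds) = marks (drop m ds)"
proof (induction ds arbitrary: m)
  case (Cons d ds)
  then show ?case by (cases m) auto
qed simp

definition remaining :: "bool list \<Rightarrow> nat \<Rightarrow> nat" where
  "remaining bs i = length ((drop_block ^^ i) bs)"

lemma remaining_0 [simp]: "remaining bs 0 = length bs"
  by (simp add: remaining_def)

lemma remaining_Suc: "remaining bs (Suc i) = remaining (drop_block bs) i"
  by (simp add: remaining_def funpow_swap1)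

lemma remaining_Nil [simp]: "remaining [] i = 0"
  by (induction i) (simp_all add: remaining_Suc)

definition block_colors :: "nat list \<Rightarrow> nat list" where
  "block_colors ds = rev (remdups (rev ds))"

lemma set_block_colors [simp]: "set (block_colors ds) = set ds"
  by (simp add: block_colors_def)

lemma block_colors_Nil [simp]: "block_colors [] = []"
  by (simp add: block_colors_def)

lemma block_colors_Cons:
  "block_colors (d # ds) = d # filter (\<lambda>c. c \<noteq> d) (block_colors ds)"
proof -
  have "remdups (xs @ [d]) = filter (\<lambda>c. c \<noteq> d) (remdups xs) @ [d]" for xs
    by (induction xs) auto
  then show ?thesis by (simp add: block_colors_def rev_filter)
qed

text \<open>
  Along the path colors only increase, so equal colors are adjacent and a mark separates
  different colors. Hence the number of edges of the $i$-th color from the end is the length of the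
  $i$-th block of marks; beyond the last color both sides vanish, which matches the padding by zeros.
\<close>

lemma count_blocks:
  assumes "sorted_wrt (\<ge>) ds"
  shows "(if i < length (block_colors ds) then count_list ds (block_colors ds ! i) else 0) =
    remaining (marks ds) i - remaining (marks ds) (Suc i)"
    and "remaining (marks ds) (Suc i) \<le> remaining (marks ds) i"
  using assms
proof (induction ds arbitrary: i)
  case Nil
  case 1
  then show ?case by simp
next
  case Nil
  case 2
  then show ?case by simp
next
  case (Cons d ds)
  have srt: "sorted_wrt (\<ge>) ds" and le: "\<And>x. x \<in> set ds \<Longrightarrow> x \<le> d"
    if "sorted_wrt (\<ge>) (d # ds)"
    using that by auto
  have dist: "distinct (block_colors ds)" by (simp add: block_colors_def)
  {
    case 1
    show ?case
    proof (cases "ds \<noteq> [] \<and> hd ds = d")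
      case True
      then obtain es where ds: "ds = d # es" by (cases ds) auto
      define cs where "cs = filter (\<lambda>c. c \<noteq> d) (block_colors es)"
      have bc: "block_colors ds = d # cs" "block_colors (d # ds) = d # cs"
        by (simp_all add: ds block_colors_Cons cs_def)
      have "d \<notin> set cs" by (simp add: cs_def)
      then have nth: "cs ! j \<noteq> d" if "j < length cs" for j
        using that nth_mem by metis
      note IH = Cons.IH(1)[OF srt[OF 1], of i, unfolded bc] Cons.IH(2)[OF srt[OF 1], of i]
      show ?thesis
      proof (cases i)
        case 0
        then show ?thesis using IH True by (simp add: bc remaining_Suc)
      next
        case (Suc j)
        then show ?thesis using IH True nth[of j]
            by (cases "j < length cs") (auto simp: bc remaining_Suc)
      qed
    next
      case False
      have "d \<notin> set ds"
      proof
        assume "d \<in> set ds"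
        then obtain e es where ds: "ds = e # es" by (cases ds) auto
        then have "e \<ge> d" using \<open>d \<in> set ds\<close> 1 by auto
        moreover have "e \<le> d" using le[OF 1] ds by simp
        ultimately show False using False ds by simp
      qed
      then have bc: "block_colors (d # ds) = d # block_colors ds"
        by (auto simp: block_colors_Cons filter_id_conv)
      have nth: "block_colors ds ! j \<noteq> d" if "j < length (block_colors ds)" for j
        using that nth_mem[OF that] \<open>d \<notin> set ds\<close> by auto
      show ?thesis
      proof (cases i)
        case 0
        then show ?thesis using False \<open>d \<notin> set ds\<close>
          by (auto simp: bc remaining_Suc count_list_0_iff)
      next
        case (Suc j)
        then show ?thesis using Cons.IH(1)[OF srt[OF 1], of j] False nth
          by (auto simp: bc remaining_Suc)
      qed
    qed
  next
    case 2
    show ?case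
      using Cons.IH(2)[OF srt[OF 2], of i] Cons.IH(2)[OF srt[OF 2], of "i - 1"]
        Cons.IH(2)[OF srt[OF 2], of 0]
      by (cases i; cases "ds = [] \<or> hd ds \<noteq> d") (auto simp: remaining_Suc intro: le_SucI)
  }
qed

definition proportions :: "bool list \<Rightarrow> nat \<Rightarrow> real" where
  "proportions bs i = (real (remaining bs i) - real (remaining bs (Suc i))) / real (length bs)"

lemma reversed_proportions_eq:
  assumes "sorted (edge_colors k x)"
  shows "reversed_proportions k x = proportions (marks (rev (edge_colors k x)))"
proof
  fix i
  let ?ds = "rev (edge_colors k x)"
  have srt: "sorted_wrt (\<ge>) ?ds" using assms by (simp add: sorted_wrt_rev)
  have "map (count_list (edge_colors k x)) (block_colors ?ds) = rev (color_counts k x)"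
    by (simp add: block_colors_def color_counts_def rev_map Let_def)
  moreover have "num_colors k x = length (block_colors ?ds)"
    by (simp add: num_colors_def block_colors_def length_remdups_card_conv)
  moreover have "count_list ?ds = count_list (edge_colors k x)"
    by (rule ext) (simp add: count_list_rev)
  ultimately have "rev (color_counts k x) ! i = count_list ?ds (block_colors ?ds ! i)"
      if "i < num_colors k x"
    using that by (metis nth_map)
  with \<open>num_colors k x = _\<close> show "reversed_proportions k x i = proportions (marks ?ds) i"
    using count_blocks(1)[OF srt, of i] count_blocks(2)[OF srt, of i]
    by (auto simp: reversed_proportions_def proportions_def path_length_def
        simp flip: of_nat_diff split: if_splits)
qed

text \<open>
  Invariant of \<^const>\<open>lerw_step\<close> for a walk that stays in \<open>V\<close>.
\<close>

fun valid :: "nat set \<Rightarrow> colored_path \<Rightarrow> bool" where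
  "valid V (ys, cs, c) \<longleftrightarrow>
     distinct ys \<and> set ys \<subseteq> V \<and> length ys = Suc (length cs) \<and> sorted (cs @ [c])"

fun shape :: "colored_path \<Rightarrow> bool list" where
  "shape (ys, cs, c) = marks (rev (cs @ [c]))"

lemma takeWhile_neq_nth:
  assumes "distinct ys" "j < length ys"
  shows "takeWhile (\<lambda>y. y \<noteq> ys ! j) ys = take j ys"
  using assms
  by (intro takeWhile_eq_take_P_nth) (auto simp: nth_eq_iff_index_eq)

lemma lerw_step_loop:
  assumes "valid V (ys, cs, c)" "j < length ys"
  shows "lerw_step (ys ! j) (ys, cs, c) = (take (Suc j) ys, take j cs, Suc c)"
  using assms takeWhile_neq_nth[of ys j]
  by (simp add: take_Suc_conv_app_nth)

lemma valid_step:
  assumes "valid V st" "v \<in> V"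
  shows "valid V (lerw_step v st)"
proof -
  obtain ys cs c where st: "st = (ys, cs, c)" by (cases st) auto
  show ?thesis
  proof (cases "v \<in> set ys")
    case True
    then obtain j where j: "j < length ys" "v = ys ! j" by (metis in_set_conv_nth)
    have "sorted cs" "\<forall>x\<in>set cs. x \<le> c"
      using assms st by (auto simp: sorted_append)
    then have "sorted (take j cs)" "\<forall>x\<in>set (take j cs). x \<le> Suc c"
      by (auto simp: sorted_wrt_take) (meson in_set_takeD le_SucI)
    then show ?thesis
      using assms st lerw_step_loop[of V ys cs c j] j
      by (auto simp: sorted_append dest: in_set_takeD)
  next
    case False
    then show ?thesis using assms st by (auto simp: sorted_append)
  qed
qed

lemma shape_step_loop:
  assumes "valid V (ys, cs, c)" "j < length ys"
  shows "shape (lerw_step (ys ! j) (ys, cs, c)) =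
    True # drop (length ys - j) (shape (ys, cs, c))"
proof -
  have len: "length ys = Suc (length cs)" using assms by simp
  let ?ds = "drop (length ys - j) (rev (cs @ [c]))"
  have ds: "rev (take j cs) = ?ds"
    using assms len by (simp add: rev_take Suc_diff_le)
  have "Suc c \<notin> set cs"
    using assms by (auto simp: sorted_append)
  then have "Suc c \<notin> set ?ds"
    unfolding ds[symmetric] by (auto dest: in_set_takeD)
  then have "?ds = [] \<or> hd ?ds \<noteq> Suc c"
    by (metis hd_in_set)
  then have "marks (Suc c # rev (take j cs)) = True # marks ?ds"
    unfolding ds by simp
  then show ?thesis
    by (simp add: lerw_step_loop[OF assms] drop_marks del: lerw_step.simps marks.simps)
qed

lemma shape_step_append:
  assumes "v \<notin> set (fst st)"
  shows "shape (lerw_step v st) = False # shape st"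
  using assms by (cases st) simp

lemma length_shape: "valid V st \<Longrightarrow> length (shape st) = length (fst st)"
  by (cases st) simp

lemma length_shape_le:
  assumes "valid {k<..N} st"
  shows "length (shape st) \<le> N - k"
proof -
  obtain ys cs c where st: "st = (ys, cs, c)" by (cases st) auto
  then have "card (set ys) \<le> card {k<..N}" "card (set ys) = length ys"
    using assms card_mono[of "{k<..N}" "set ys"] distinct_card[of ys] by auto
  then show ?thesis using length_shape[OF assms] st by simp
qed

text \<open>
  The reason why the marks alone form a Markov chain: of the vertices in $\{k+1,\ldots,N\}$, those on
  the path give one truncation for each length, and all the others have the same effect.
\<close>

lemma sum_shape_step:
  assumes "valid {k<..N} st" "N > k"
  shows "(\<Sum>v\<in>{k<..N}. \<phi> (shape (lerw_step v st))) = real N * shape_kernel N k \<phi> (shape st)"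
proof -
  obtain ys cs c where st: "st = (ys, cs, c)" by (cases st) auto
  have sub: "set ys \<subseteq> {k<..N}" and dist: "distinct ys" using assms st by auto
  have card: "card (set ys) = length ys" using dist by (rule distinct_card)
  have "length ys \<le> N - k"
    using length_shape_le[OF assms(1)] length_shape[OF assms(1)] st by simp
  have "(\<Sum>v\<in>{k<..N}. \<phi> (shape (lerw_step v st))) =
    (\<Sum>v\<in>{k<..N} - set ys. \<phi> (shape (lerw_step v st))) + (\<Sum>v\<in>set ys. \<phi> (shape (lerw_step v st)))"
    using sub by (intro sum.subset_diff) auto
  also have "(\<Sum>v\<in>{k<..N} - set ys. \<phi> (shape (lerw_step v st))) =
      (\<Sum>v\<in>{k<..N} - set ys. \<phi> (False # shape st))"
    by (intro sum.cong refl) (auto simp: shape_step_append st simp del: shape.simps lerw_step.simps)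
  also have "\<dots> = (real N - real k - real (length ys)) * \<phi> (False # shape st)"
    using sub card \<open>length ys \<le> N - k\<close> assms(2) by (simp add: card_Diff_subset of_nat_diff)
  also have "(\<Sum>v\<in>set ys. \<phi> (shape (lerw_step v st))) =
      (\<Sum>j<length ys. \<phi> (shape (lerw_step (ys ! j) st)))"
    using bij_betw_nth[OF dist refl refl] by (intro sum.reindex_bij_betw[symmetric]) auto
  also have "\<dots> = (\<Sum>j<length ys. \<phi> (True # drop (length ys - j) (shape st)))"
    using assms(1) unfolding st
    by (intro sum.cong refl) (subst shape_step_loop, auto simp del: shape.simps lerw_step.simps)
  finally show ?thesis
    using assms length_shape[OF assms(1)] by (simp add: shape_kernel_def st del: shape.simps)
qed

lemma lerw_cong: "(\<And>s. s \<le> t \<Longrightarrow> x s = y s) \<Longrightarrow> lerw x t = lerw y t"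
  by (induction t) auto

lemma valid_lerw:
  "(\<And>s. s \<le> t \<Longrightarrow> x s \<in> V) \<Longrightarrow> valid V (lerw x t)"
  by (induction t) (auto intro: valid_step)

lemma edge_colors_hit:
  assumes "\<And>s. s \<le> t \<Longrightarrow> x s \<in> {k<..N}" "x (Suc t) \<in> {1..k}"
  shows "sorted (edge_colors k x)" "marks (rev (edge_colors k x)) = shape (lerw x t)"
proof -
  have "hitting_time k x = Suc t"
    unfolding hitting_time_def
  proof (rule Least_equality)
    fix s assume "x s \<in> {1..k}"
    then show "Suc t \<le> s" using assms(1)[of s] by (cases "s \<le> t") auto
  qed (use assms in simp)
  moreover obtain ys cs c where st: "lerw x t = (ys, cs, c)" by (cases "lerw x t") auto
  moreover have v: "valid {k<..N} (lerw x t)" by (rule valid_lerw) (use assms in auto)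
  moreover have "x (Suc t) \<notin> set ys" using v assms(2) st by auto
  ultimately have "edge_colors k x = cs @ [c]" by (simp add: edge_colors_def)
  with v st show "sorted (edge_colors k x)" "marks (rev (edge_colors k x)) = shape (lerw x t)"
    by simp_all
qed

section \<open>The walk before it hits the target\<close>

lemma (in prob_space) indep_vars_split_integral:
  fixes G :: "('i \<Rightarrow> 'b) \<Rightarrow> real"
  assumes ind: "indep_vars (\<lambda>_. S) X I" and "i \<in> I" "A \<subseteq> I" "i \<notin> A" and B: "B \<in> sets S"
    and G: "G \<in> borel_measurable (PiM A (\<lambda>_. S))" and bd: "\<And>v. \<bar>G v\<bar> \<le> C"
  shows "(\<integral>\<omega>. indicator B (X i \<omega>) * G (restrict (\<lambda>j. X j \<omega>) A) \<partial>M) =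
    prob (X i -` B \<inter> space M) * (\<integral>\<omega>. G (restrict (\<lambda>j. X j \<omega>) A) \<partial>M)"
proof -
  have X: "X i \<in> measurable M S" using ind \<open>i \<in> I\<close> by (auto simp: indep_vars_def)
  have ev: "(\<lambda>v. indicator B (v i) :: real) \<in> borel_measurable (PiM {i} (\<lambda>_. S))"
    using B by measurable
  have "indep_var (PiM {i} (\<lambda>_. S)) (\<lambda>\<omega>. restrict (\<lambda>j. X j \<omega>) {i})
      (PiM A (\<lambda>_. S)) (\<lambda>\<omega>. restrict (\<lambda>j. X j \<omega>) A)"
    using assms by (intro indep_var_restrict[OF ind]) auto
  from indep_var_compose[OF this ev G]
  have iv: "indep_var borel (\<lambda>\<omega>. indicator B (X i \<omega>) :: real)
      borel (\<lambda>\<omega>. G (restrict (\<lambda>j. X j \<omega>) A))"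
    by (simp add: comp_def)
  have int: "integrable M (\<lambda>\<omega>. indicator B (X i \<omega>) :: real)"
      "integrable M (\<lambda>\<omega>. G (restrict (\<lambda>j. X j \<omega>) A))"
    using indep_var_rv1[OF iv] indep_var_rv2[OF iv] bd
    by (auto intro: integrable_const_bound[where B=1] integrable_const_bound[where B=C]
        simp: indicator_le_1)
  have "(\<integral>\<omega>. indicator B (X i \<omega>) \<partial>M) = (\<integral>\<omega>. indicator (X i -` B \<inter> space M) \<omega> \<partial>M)"
    by (intro Bochner_Integration.integral_cong) (auto split: split_indicator)
  also have "\<dots> = prob (X i -` B \<inter> space M)"
    using X B by simp
  finally show ?thesis using indep_var_lebesgue_integral[OF iv int] by simp
qed

definition in_play :: "nat \<Rightarrow> nat \<Rightarrow> (nat \<Rightarrow> nat) \<Rightarrow> nat \<Rightarrow> bool" where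
  "in_play N k x t \<longleftrightarrow> (\<forall>s\<le>t. x s \<in> {k<..N})"

lemma in_play_Suc: "in_play N k x (Suc t) \<longleftrightarrow> in_play N k x t \<and> x (Suc t) \<in> {k<..N}"
  by (auto simp: in_play_def le_Suc_eq)

definition adapted :: "nat \<Rightarrow> ((nat \<Rightarrow> nat) \<Rightarrow> 'c) \<Rightarrow> bool" where
  "adapted t g \<longleftrightarrow> (\<forall>x y. (\<forall>s\<le>t. x s = y s) \<longrightarrow> g x = g y)"

lemma in_play_cong: "(\<And>s. s \<le> t \<Longrightarrow> x s = y s) \<Longrightarrow> in_play N k x t = in_play N k y t"
  by (auto simp: in_play_def)

lemma adapted_state: "adapted t (\<lambda>x. F (in_play N k x t) (lerw x t))"
  unfolding adapted_def
proof (intro allI impI)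
  fix x y :: "nat \<Rightarrow> nat" assume "\<forall>s\<le>t. x s = y s"
  then have "in_play N k x t = in_play N k y t" "lerw x t = lerw y t"
    by (auto intro!: in_play_cong lerw_cong)
  then show "F (in_play N k x t) (lerw x t) = F (in_play N k y t) (lerw y t)"
    by (simp only:)
qed

locale walk = prob_space M for M :: "'a measure" +
  fixes N k :: nat and X :: "nat \<Rightarrow> 'a \<Rightarrow> nat"
  assumes k: "k \<ge> 1" and N: "N > k" and walk: "uniform_walk M N X"
begin

lemma X0: "\<omega> \<in> space M \<Longrightarrow> X 0 \<omega> = N"
  using walk by (simp add: uniform_walk_def)

lemma indep: "indep_vars (\<lambda>_. count_space UNIV) X {1..}"
  using walk by (simp add: uniform_walk_def)

lemma X_measurable [measurable]: "X t \<in> measurable M (count_space UNIV)"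
proof (cases "t = 0")
  case True
  then show ?thesis using X0 by (subst measurable_cong[where g = "\<lambda>_. N"]) auto
next
  case False
  then show ?thesis using indep by (auto simp: indep_vars_def)
qed

lemma prob_X:
  assumes "t \<ge> 1"
  shows "prob (X t -` B \<inter> space M) = real (card ({1..N} \<inter> B)) / real N"
proof -
  have "prob (X t -` B \<inter> space M) = measure (distr M (count_space UNIV) (X t)) B"
    by (simp add: measure_distr)
  also have "\<dots> = measure (measure_pmf (pmf_of_set {1..N})) B"
    using walk assms by (simp add: uniform_walk_def)
  also have "\<dots> = real (card ({1..N} \<inter> B)) / real N"
    using N by (subst measure_pmf_of_set) auto
  finally show ?thesis .
qed

abbreviation path :: "'a \<Rightarrow> nat \<Rightarrow> nat" where
  "path \<omega> \<equiv> \<lambda>t. X t \<omega>"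

lemma past_measurable:
  fixes g :: "(nat \<Rightarrow> nat) \<Rightarrow> real"
  assumes "adapted t g"
  shows "\<exists>G. G \<in> borel_measurable (PiM {1..t} (\<lambda>_. count_space UNIV)) \<and>
    (\<forall>\<omega>\<in>space M. g (path \<omega>) = G (restrict (path \<omega>) {1..t})) \<and> range G \<subseteq> range g"
proof (intro exI conjI ballI)
  \<comment> \<open>Time 0 is not one of the independent variables; its value is the constant \<open>N\<close>.\<close>
  let ?G = "\<lambda>v. g (\<lambda>s. if s = 0 then N else v s)"
  show "?G \<in> borel_measurable (PiM {1..t} (\<lambda>_. count_space UNIV))"
    by (subst count_space_PiM_finite) auto
  fix \<omega> assume "\<omega> \<in> space M"
  then show "g (path \<omega>) = ?G (restrict (path \<omega>) {1..t})"
    by (intro assms[unfolded adapted_def, rule_format]) (auto simp: X0)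
qed auto

lemma past_borel_measurable:
  fixes g :: "(nat \<Rightarrow> nat) \<Rightarrow> real"
  assumes "adapted t g"
  shows "(\<lambda>\<omega>. g (path \<omega>)) \<in> borel_measurable M"
proof -
  obtain G where G: "G \<in> borel_measurable (PiM {1..t} (\<lambda>_. count_space UNIV))"
    "\<And>\<omega>. \<omega> \<in> space M \<Longrightarrow> g (path \<omega>) = G (restrict (path \<omega>) {1..t})"
    using past_measurable[OF assms] by blast
  have "(\<lambda>\<omega>. restrict (path \<omega>) {1..t}) \<in> measurable M (PiM {1..t} (\<lambda>_. count_space UNIV))"
    by (intro measurable_restrict) simp
  from measurable_compose[OF this G(1)] show ?thesis
    by (subst measurable_cong[OF G(2)])
qed

text \<open>
  The Markov property of the walk: the next draw is uniform and independent of the past.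
\<close>

lemma integral_next_step:
  fixes g :: "(nat \<Rightarrow> nat) \<Rightarrow> real"
  assumes dep: "adapted t g" and bd: "\<And>x. \<bar>g x\<bar> \<le> C"
  shows "(\<integral>\<omega>. indicator B (X (Suc t) \<omega>) * g (path \<omega>) \<partial>M) =
    real (card ({1..N} \<inter> B)) / real N * (\<integral>\<omega>. g (path \<omega>) \<partial>M)"
proof -
  obtain G where G: "G \<in> borel_measurable (PiM {1..t} (\<lambda>_. count_space UNIV))"
    "\<And>\<omega>. \<omega> \<in> space M \<Longrightarrow> g (path \<omega>) = G (restrict (path \<omega>) {1..t})" "range G \<subseteq> range g"
    using past_measurable[OF dep] by blast
  have "\<bar>G v\<bar> \<le> C" for v
  proof -
    have "G v \<in> range g" using G(3) by blast
    then show ?thesis using bd by auto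
  qed
  from indep_vars_split_integral[OF indep, of "Suc t" "{1..t}" B G C] this G(1)
  have "(\<integral>\<omega>. indicator B (X (Suc t) \<omega>) * G (restrict (path \<omega>) {1..t}) \<partial>M) =
    prob (X (Suc t) -` B \<inter> space M) * (\<integral>\<omega>. G (restrict (path \<omega>) {1..t}) \<partial>M)"
    by auto
  moreover have "(\<integral>\<omega>. indicator B (X (Suc t) \<omega>) * g (path \<omega>) \<partial>M) =
    (\<integral>\<omega>. indicator B (X (Suc t) \<omega>) * G (restrict (path \<omega>) {1..t}) \<partial>M)"
    by (intro Bochner_Integration.integral_cong refl arg_cong2[where f = "(*)"] G(2))
  moreover have "(\<integral>\<omega>. g (path \<omega>) \<partial>M) = (\<integral>\<omega>. G (restrict (path \<omega>) {1..t}) \<partial>M)"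
    by (intro Bochner_Integration.integral_cong refl G(2))
  ultimately show ?thesis
    using prob_X[of "Suc t" B] by (simp only:)
qed

definition live_mean :: "nat \<Rightarrow> (bool list \<Rightarrow> real) \<Rightarrow> real" where
  "live_mean t \<phi> = (\<integral>\<omega>. of_bool (in_play N k (path \<omega>) t) * \<phi> (shape (lerw (path \<omega>) t)) \<partial>M)"

lemma live_mean_0: "live_mean 0 \<phi> = \<phi> [True]"
proof -
  have "live_mean 0 \<phi> = (\<integral>\<omega>. \<phi> [True] \<partial>M)"
    unfolding live_mean_def using N by (intro Bochner_Integration.integral_cong) (auto simp: in_play_def X0)
  then show ?thesis by (simp add: prob_space)
qed

lemma live_mean_Suc:
  assumes bd: "\<And>bs. length bs \<le> N - k \<Longrightarrow> \<bar>\<phi> bs\<bar> \<le> C"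
  shows "live_mean (Suc t) \<phi> = live_mean t (shape_kernel N k \<phi>)"
proof -
  define g where "g v x = of_bool (in_play N k x t) * \<phi> (shape (lerw_step v (lerw x t)))" for v x
  have dep: "adapted t (g v)" for v
    unfolding g_def by (rule adapted_state)
  have "0 \<le> C" using bd[of "[]"] by simp
  have gbd: "\<bar>g v x\<bar> \<le> C" if "v \<in> {k<..N}" for v x
  proof (cases "in_play N k x t")
    case True
    then have "valid {k<..N} (lerw x t)"
      by (intro valid_lerw) (auto simp: in_play_def)
    then show ?thesis
      using bd[OF length_shape_le[OF valid_step[OF _ that]]] True by (simp add: g_def)
  qed (use \<open>0 \<le> C\<close> in \<open>simp add: g_def\<close>)
  have gm: "(\<lambda>\<omega>. g v (path \<omega>)) \<in> borel_measurable M" for v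
    by (rule past_borel_measurable) (rule dep)
  have gi: "integrable M (\<lambda>\<omega>. g v (path \<omega>))" if "v \<in> {k<..N}" for v
    using that gm gbd by (intro integrable_const_bound[where B=C]) auto
  have im: "(\<lambda>\<omega>. indicator {v} (X (Suc t) \<omega>) :: real) \<in> borel_measurable M" for v
    by (rule measurable_compose[OF X_measurable]) simp
  have gi': "integrable M (\<lambda>\<omega>. indicator {v} (X (Suc t) \<omega>) * g v (path \<omega>))" if "v \<in> {k<..N}" for v
    using that gbd \<open>0 \<le> C\<close> by (intro integrable_const_bound[where B=C])
      (auto simp: abs_mult split: split_indicator intro!: borel_measurable_times gm im)
  have "live_mean (Suc t) \<phi> =
      (\<integral>\<omega>. (\<Sum>v\<in>{k<..N}. indicator {v} (X (Suc t) \<omega>) * g v (path \<omega>)) \<partial>M)"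
    unfolding live_mean_def
  proof (rule Bochner_Integration.integral_cong[OF refl])
    fix \<omega>
    let ?v = "X (Suc t) \<omega>"
    have "(\<Sum>v\<in>{k<..N}. indicator {v} ?v * g v (path \<omega>)) =
        (\<Sum>v\<in>{k<..N}. if v = ?v then g v (path \<omega>) else 0)"
      by (intro sum.cong) auto
    also have "\<dots> = (if ?v \<in> {k<..N} then g ?v (path \<omega>) else 0)"
      by (rule sum.delta) simp
    finally show "of_bool (in_play N k (path \<omega>) (Suc t)) * \<phi> (shape (lerw (path \<omega>) (Suc t))) =
        (\<Sum>v\<in>{k<..N}. indicator {v} ?v * g v (path \<omega>))"
      by (simp add: in_play_Suc g_def)
  qed
  also have "\<dots> = (\<Sum>v\<in>{k<..N}. \<integral>\<omega>. indicator {v} (X (Suc t) \<omega>) * g v (path \<omega>) \<partial>M)"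
    using gi' by (rule Bochner_Integration.integral_sum)
  also have "\<dots> = (\<Sum>v\<in>{k<..N}. 1 / real N * (\<integral>\<omega>. g v (path \<omega>) \<partial>M))"
  proof (rule sum.cong[OF refl])
    fix v assume v: "v \<in> {k<..N}"
    then have "{1..N} \<inter> {v} = {v}" by auto
    then have "card ({1..N} \<inter> {v}) = 1" by simp
    with integral_next_step[OF dep gbd[OF v], of "{v}"] show "(\<integral>\<omega>. indicator {v} (X (Suc t) \<omega>) * g v (path \<omega>) \<partial>M) =
        1 / real N * (\<integral>\<omega>. g v (path \<omega>) \<partial>M)"
      by (simp only: of_nat_1)
  qed
  also have "\<dots> = (\<integral>\<omega>. 1 / real N * (\<Sum>v\<in>{k<..N}. g v (path \<omega>)) \<partial>M)"
    using gi by (subst integral_mult_right_zero, subst Bochner_Integration.integral_sum)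
      (simp_all only: sum_distrib_left)
  also have "\<dots> = live_mean t (shape_kernel N k \<phi>)"
    unfolding live_mean_def
  proof (rule Bochner_Integration.integral_cong[OF refl])
    fix \<omega>
    show "1 / real N * (\<Sum>v\<in>{k<..N}. g v (path \<omega>)) =
        of_bool (in_play N k (path \<omega>) t) * shape_kernel N k \<phi> (shape (lerw (path \<omega>) t))"
    proof (cases "in_play N k (path \<omega>) t")
      case True
      then have "valid {k<..N} (lerw (path \<omega>) t)"
        by (intro valid_lerw) (auto simp: in_play_def)
      then show ?thesis
        using True N by (simp add: g_def sum_shape_step)
    qed (simp add: g_def)
  qed
  finally show ?thesis .
qed

end

section \<open>Exact law at the hitting time\<close>

context walk
begin

lemma live_mean_eq:
  assumes "\<And>bs. length bs \<le> N - k \<Longrightarrow> \<bar>\<phi> bs\<bar> \<le> C"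
  shows "live_mean t \<phi> = (shape_kernel N k ^^ t) \<phi> [True]"
  using assms
proof (induction t arbitrary: \<phi> C)
  case 0
  then show ?case by (simp add: live_mean_0)
next
  case (Suc t)
  have "live_mean (Suc t) \<phi> = live_mean t (shape_kernel N k \<phi>)"
    by (rule live_mean_Suc) (rule Suc.prems)
  also have "\<dots> = (shape_kernel N k ^^ t) (shape_kernel N k \<phi>) [True]"
    by (rule Suc.IH) (rule shape_kernel_abs_le[OF N Suc.prems])
  finally show ?case by (simp add: funpow_swap1)
qed

lemma AE_range: "AE \<omega> in M. \<forall>t. X t \<omega> \<in> {1..N}"
proof (subst AE_all_countable, rule allI)
  fix t
  show "AE \<omega> in M. X t \<omega> \<in> {1..N}"
  proof (cases "t = 0")
    case True
    then show ?thesis using X0 N by (intro AE_I2) auto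
  next
    case False
    then have "prob (X t -` {1..N} \<inter> space M) = 1"
      using prob_X[of t "{1..N}"] N by simp
    then show ?thesis
      by (subst (asm) prob_eq_1) (auto elim: eventually_mono)
  qed
qed

lemma hitting_time_measurable: "(\<lambda>\<omega>. hitting_time k (path \<omega>)) \<in> measurable M (count_space UNIV)"
  unfolding hitting_time_def 
  by (intro measurable_Least measurable_compose[OF X_measurable]) simp

text \<open>
  The state at the hitting time takes countably many values. Where $[k]$ is never hit, that time is
  still one fixed natural number, so measurability holds without removing this null event.
\<close>

lemma final_measurable:
  fixes H :: "(nat \<Rightarrow> real) \<Rightarrow> real"
  shows "(\<lambda>\<omega>. H (reversed_proportions k (path \<omega>))) \<in> borel_measurable M"
proof -
  define R :: "colored_path \<Rightarrow> nat \<Rightarrow> real" where "R st i =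
    (let cs = fst (snd st) in if i < card (set cs)
      then real (rev (map (count_list cs) (remdups cs)) ! i) / real (length cs) else 0)" for st i
  have "reversed_proportions k x = R (lerw x (hitting_time k x))" for x
    by (rule ext)
      (simp add: reversed_proportions_def R_def num_colors_def color_counts_def path_length_def
        edge_colors_def Let_def)
  moreover have "(\<lambda>\<omega>. H (R (lerw (path \<omega>) t))) \<in> borel_measurable M" for t
    by (rule past_borel_measurable[where t = t]) (rule adapted_state)
  ultimately show ?thesis
    using measurable_compose_countable[OF _ hitting_time_measurable,
        of "\<lambda>t \<omega>. H (R (lerw (path \<omega>) t))"] by simp
qed

text \<open>
  Conditioning on the last time before the hit gives $k/N$ times the expected total of
  the functional along the walk, up to the event that the walk is still running at time
  \<open>T\<close>. The occupation measure satisfies the same identity with another remainder, and both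
  remainders vanish as \<open>T\<close> grows.
\<close>

lemma expectation_final:
  fixes H :: "(nat \<Rightarrow> real) \<Rightarrow> real"
  assumes bd: "\<And>v. \<bar>H v\<bar> \<le> B"
  shows "(\<integral>\<omega>. H (reversed_proportions k (path \<omega>)) \<partial>M) =
    (\<Sum>n=1..N - k. survival N k n * real (n + k) / real N * mark_mean k n (\<lambda>bs. H (proportions bs)))"
proof -
  define \<psi> where "\<psi> bs = H (proportions bs)" for bs
  define h where "h x = H (reversed_proportions k x)" for x
  define g where "g t x = of_bool (in_play N k x t) * \<psi> (shape (lerw x t))" for t x
  have "0 \<le> B" using bd[of "\<lambda>_. 0"] by linarith
  have \<psi>: "\<bar>\<psi> bs\<bar> \<le> B" for bs using bd by (simp add: \<psi>_def)
  have gbd: "\<bar>g t x\<bar> \<le> B" for t x using \<psi> \<open>0 \<le> B\<close> by (simp add: g_def)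
  have gad: "adapted t (g t)" for t unfolding g_def by (rule adapted_state)
  have hm: "(\<lambda>\<omega>. h (path \<omega>)) \<in> borel_measurable M"
    unfolding h_def by (rule final_measurable)
  have hbd: "\<bar>h x\<bar> \<le> B" for x using bd by (simp add: h_def)
  have im: "(\<lambda>\<omega>. indicator {1..k} (X t \<omega>) :: real) \<in> borel_measurable M" for t
    by (rule measurable_compose[OF X_measurable]) simp
  have pm: "(\<lambda>\<omega>. of_bool (in_play N k (path \<omega>) T) :: real) \<in> borel_measurable M" for T
    by (rule past_borel_measurable[where t = T]) (rule adapted_state)
  have split: "h x = (\<Sum>t<T. indicator {1..k} (x (Suc t)) * g t x) + of_bool (in_play N k x T) * h x"
    if "x 0 = N" "\<And>t. x t \<in> {1..N}" for x T
  proof (induction T)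
    case 0
    then show ?case using that N by (simp add: in_play_def)
  next
    case (Suc T)
    have "of_bool (in_play N k x T) * h x =
        indicator {1..k} (x (Suc T)) * g T x + of_bool (in_play N k x (Suc T)) * h x"
    proof (cases "in_play N k x T \<and> x (Suc T) \<in> {1..k}")
      case True
      then have "h x = \<psi> (shape (lerw x T))"
        using edge_colors_hit[of T x k N] reversed_proportions_eq[of k x]
        by (simp add: in_play_def h_def \<psi>_def)
      then show ?thesis using True by (simp add: g_def in_play_Suc)
    next
      case False
      then show ?thesis using that(2)[of "Suc T"] by (auto simp: g_def in_play_Suc)
    qed
    with Suc.IH show ?case unfolding sum.lessThan_Suc by linarith
  qed
  define rest where "rest T = (\<integral>\<omega>. of_bool (in_play N k (path \<omega>) T) * h (path \<omega>) \<partial>M)" for T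
  have main: "(\<integral>\<omega>. h (path \<omega>) \<partial>M) =
      real k / real N * (occupation N k \<psi> - occupation N k ((shape_kernel N k ^^ T) \<psi>)) + rest T" for T
  proof -
    have gm: "(\<lambda>\<omega>. indicator {1..k} (X (Suc t) \<omega>) * g t (path \<omega>)) \<in> borel_measurable M" for t
      by (intro borel_measurable_times im past_borel_measurable[OF gad])
    have gi: "integrable M (\<lambda>\<omega>. indicator {1..k} (X (Suc t) \<omega>) * g t (path \<omega>))" for t
      using gbd \<open>0 \<le> B\<close> gm[of t]
      by (intro integrable_const_bound[where B=B]) (auto simp: abs_mult split: split_indicator)
    have hi: "integrable M (\<lambda>\<omega>. of_bool (in_play N k (path \<omega>) T) * h (path \<omega>))"
      using hbd \<open>0 \<le> B\<close>
      by (intro integrable_const_bound[where B=B])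
        (auto intro!: borel_measurable_times pm hm)
    have "(\<integral>\<omega>. h (path \<omega>) \<partial>M) =
        (\<integral>\<omega>. (\<Sum>t<T. indicator {1..k} (X (Suc t) \<omega>) * g t (path \<omega>)) +
          of_bool (in_play N k (path \<omega>) T) * h (path \<omega>) \<partial>M)"
    proof (rule integral_cong_AE)
      show "AE \<omega> in M. h (path \<omega>) = (\<Sum>t<T. indicator {1..k} (X (Suc t) \<omega>) * g t (path \<omega>)) +
          of_bool (in_play N k (path \<omega>) T) * h (path \<omega>)"
        using AE_range AE_space by eventually_elim (rule split, auto simp: X0)
    qed (intro hm borel_measurable_add borel_measurable_sum gm borel_measurable_integrable[OF hi])+
    also have "\<dots> = (\<Sum>t<T. \<integral>\<omega>. indicator {1..k} (X (Suc t) \<omega>) * g t (path \<omega>) \<partial>M) + rest T"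
      unfolding rest_def
      by (subst Bochner_Integration.integral_add[OF Bochner_Integration.integrable_sum[OF gi] hi],
          subst Bochner_Integration.integral_sum[OF gi]) (rule refl)
    also have "(\<Sum>t<T. \<integral>\<omega>. indicator {1..k} (X (Suc t) \<omega>) * g t (path \<omega>) \<partial>M) =
        (\<Sum>t<T. real k / real N * (shape_kernel N k ^^ t) \<psi> [True])"
    proof (rule sum.cong[OF refl])
      fix t
      have "min N k = k" using N by simp
      then have "(\<integral>\<omega>. indicator {1..k} (X (Suc t) \<omega>) * g t (path \<omega>) \<partial>M) =
          real k / real N * live_mean t \<psi>"
        using integral_next_step[OF gad gbd, where B = "{1..k}"]
        by (simp add: live_mean_def g_def)
      then show "(\<integral>\<omega>. indicator {1..k} (X (Suc t) \<omega>) * g t (path \<omega>) \<partial>M) =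
          real k / real N * (shape_kernel N k ^^ t) \<psi> [True]"
        using live_mean_eq[OF \<psi>] by simp
    qed
    also have "\<dots> = real k / real N * (occupation N k \<psi> - occupation N k ((shape_kernel N k ^^ T) \<psi>))"
      using occupation_iterate[OF k N, of \<psi> T] by (simp add: sum_distrib_left)
    finally show ?thesis .
  qed
  have "rest \<longlonglongrightarrow> 0"
  proof (rule Lim_null_comparison)
    have "\<bar>rest T\<bar> \<le> B * (1 - real k / real N) ^ T" for T
    proof -
      have "\<bar>rest T\<bar> \<le> (\<integral>\<omega>. B * of_bool (in_play N k (path \<omega>) T) \<partial>M)"
        unfolding rest_def
      proof (rule order.trans[OF integral_abs_bound integral_mono'])
        show "integrable M (\<lambda>\<omega>. B * of_bool (in_play N k (path \<omega>) T))"
          using \<open>0 \<le> B\<close> by (intro integrable_const_bound[where B=B])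
            (auto intro!: borel_measurable_times pm)
      qed (use hbd \<open>0 \<le> B\<close> in auto)
      also have "\<dots> = B * live_mean T (\<lambda>_. 1)"
        by (simp add: live_mean_def)
      also have "live_mean T (\<lambda>_. 1) = (shape_kernel N k ^^ T) (\<lambda>_. 1) [True]"
        by (rule live_mean_eq[where C = 1]) simp
      also have "\<dots> \<le> (1 - real k / real N) ^ T"
        using shape_kernel_iterate_abs_le[OF N, of "\<lambda>_. 1" 1 "[True]" T] N
        by (simp add: Suc_le_eq)
      finally show ?thesis using \<open>0 \<le> B\<close> by (simp add: mult_left_mono)
    qed
    then show "\<forall>\<^sub>F T in sequentially. norm (rest T) \<le> B * (1 - real k / real N) ^ T" by simp
    show "(\<lambda>T. B * (1 - real k / real N) ^ T) \<longlonglongrightarrow> 0"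
      using k N by (intro tendsto_mult_right_zero LIMSEQ_power_zero) (auto simp: field_simps)
  qed
  moreover have "(\<lambda>T. occupation N k ((shape_kernel N k ^^ T) \<psi>)) \<longlonglongrightarrow> 0"
    by (rule occupation_LIMSEQ[OF k N \<psi>])
  ultimately have "(\<lambda>T. real k / real N * (occupation N k \<psi> - occupation N k ((shape_kernel N k ^^ T) \<psi>)) + rest T)
      \<longlonglongrightarrow> real k / real N * (occupation N k \<psi> - 0) + 0"
    by (intro tendsto_intros)
  then have "(\<integral>\<omega>. h (path \<omega>) \<partial>M) = real k / real N * occupation N k \<psi>"
    unfolding main[symmetric] by (simp add: LIMSEQ_const_iff)
  also have "\<dots> = (\<Sum>n=1..N - k. survival N k n * real (n + k) / real N * mark_mean k n \<psi>)"
    using k N unfolding occupation_def sum_distrib_left by (intro sum.cong) auto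
  finally show ?thesis unfolding h_def \<psi>_def .
qed

end

text \<open>
  The weights sum to one, and each of them is at most \<open>(n + k) / N\<close>, so any fixed finite
  part of the sequence becomes negligible.
\<close>

lemma survival_average_LIMSEQ:
  assumes F: "F \<longlonglongrightarrow> L"
  shows "(\<lambda>N. \<Sum>n=1..N - k. survival N k n * real (n + k) / real N * F n) \<longlonglongrightarrow> L"
proof (rule LIMSEQ_I)
  fix e :: real assume "0 < e"
  let ?q = "\<lambda>N n. survival N k n * real (n + k) / real N"
  have "convergent (\<lambda>n. F n - L)" by (rule convergentI[OF tendsto_diff[OF F tendsto_const]])
  then obtain D where D: "\<And>n. \<bar>F n - L\<bar> \<le> D" "0 < D"
    by (metis BseqE convergent_imp_Bseq real_norm_def)
  obtain n0 where n0: "\<And>n. n \<ge> n0 \<Longrightarrow> \<bar>F n - L\<bar> < e / 2"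
    using LIMSEQ_D[OF F, of "e / 2"] \<open>0 < e\<close> by auto
  define C where "C = (\<Sum>n<n0. D * real (n + k))"
  obtain N0 :: nat where N0: "C / (e / 2) < real N0" using reals_Archimedean2 by blast
  show "\<exists>no. \<forall>N\<ge>no. norm ((\<Sum>n=1..N - k. ?q N n * F n) - L) < e"
  proof (intro exI allI impI)
    fix N assume "N \<ge> max N0 (Suc k)"
    then have "N > k" "N0 \<le> N" by auto
    have q: "0 \<le> ?q N n" "?q N n \<le> real (n + k) / real N" if "n \<in> {1..N - k}" for n
      using survival_bounds[OF \<open>N > k\<close>, of n] that
      by (auto intro!: divide_right_mono mult_left_le_one_le)
    have one: "(\<Sum>n=1..N - k. ?q N n) = 1"
      using survival_telescope[of k N 1] \<open>N > k\<close> by (simp add: survival_1)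
    have "(\<Sum>n=1..N - k. ?q N n * F n) - L = (\<Sum>n=1..N - k. ?q N n * (F n - L))"
      unfolding right_diff_distrib sum_subtractf sum_distrib_right[symmetric] one by simp
    also have "\<bar>\<dots>\<bar> \<le> (\<Sum>n=1..N - k. ?q N n * \<bar>F n - L\<bar>)"
    proof (rule order.trans[OF sum_abs sum_mono])
      fix n assume "n \<in> {1..N - k}"
      then show "\<bar>?q N n * (F n - L)\<bar> \<le> ?q N n * \<bar>F n - L\<bar>"
        unfolding abs_mult[of "?q N n"] by (simp only: abs_of_nonneg[OF q(1)] order.refl)
    qed
    also have "\<dots> \<le> (\<Sum>n=1..N - k. (if n < n0 then D * real (n + k) / real N else 0) + ?q N n * (e / 2))"
    proof (rule sum_mono)
      fix n assume n: "n \<in> {1..N - k}"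
      show "?q N n * \<bar>F n - L\<bar> \<le> (if n < n0 then D * real (n + k) / real N else 0) + ?q N n * (e / 2)"
      proof (cases "n < n0")
        case True
        have "?q N n * \<bar>F n - L\<bar> \<le> real (n + k) / real N * D"
          using q[OF n] D by (intro mult_mono) auto
        moreover have "0 \<le> ?q N n * (e / 2)" using q(1)[OF n] \<open>0 < e\<close> by (intro mult_nonneg_nonneg) auto
        ultimately show ?thesis using True by (simp add: mult.commute)
      next
        case False
        then have "?q N n * \<bar>F n - L\<bar> \<le> ?q N n * (e / 2)"
          using q(1)[OF n] n0[of n] by (intro mult_left_mono) auto
        then show ?thesis using False by simp
      qed
    qed
    also have "\<dots> = (\<Sum>n=1..N - k. if n < n0 then D * real (n + k) / real N else 0) + e / 2"
      unfolding sum.distrib sum_distrib_right[symmetric] one by simp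
    also have "(\<Sum>n=1..N - k. if n < n0 then D * real (n + k) / real N else 0) =
        (\<Sum>n\<in>{1..N - k} \<inter> {..<n0}. D * real (n + k) / real N)"
      by (subst sum.inter_restrict) auto
    also have "\<dots> \<le> (\<Sum>n<n0. D * real (n + k) / real N)"
      using D(2) by (intro sum_mono2) auto
    also have "\<dots> = C / real N" by (simp add: C_def sum_divide_distrib)
    also have "\<dots> < e / 2"
    proof -
      have "C < e / 2 * real N0" using N0 \<open>0 < e\<close> by (simp add: field_simps)
      also have "\<dots> \<le> e / 2 * real N" using \<open>N0 \<le> N\<close> \<open>0 < e\<close> by (intro mult_left_mono) auto
      finally show ?thesis using \<open>N > k\<close> by (simp add: field_simps)
    qed
    finally show "norm ((\<Sum>n=1..N - k. ?q N n * F n) - L) < e" by simp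
  qed
qed

section \<open>Discrete stick-breaking driven by uniform variables\<close>

text \<open>
  For \<open>u\<close> uniform on the unit interval this has the law of the last marked position in
  \<open>mark_mean_drop_block\<close>; subtraction truncates at \<open>0\<close>, which is then absorbing.
\<close>

definition chop :: "nat \<Rightarrow> nat \<Rightarrow> real \<Rightarrow> nat" where
  "chop k n u = nat \<lfloor>real (n + k) * (1 - u)\<rfloor> - k"

primrec stick_left :: "nat \<Rightarrow> nat \<Rightarrow> (nat \<Rightarrow> real) \<Rightarrow> nat \<Rightarrow> nat" where
  "stick_left k n u 0 = n"
| "stick_left k n u (Suc i) = chop k (stick_left k n u i) (u i)"

lemma stick_left_Suc: "stick_left k n u (Suc i) = stick_left k (chop k n (u 0)) (\<lambda>j. u (Suc j)) i"
  by (induction i) simp_all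

lemma map_upt_Suc_shift: "map f [0..<Suc m] = f 0 # map (\<lambda>i. f (Suc i)) [0..<m]"
  by (simp add: map_upt_Suc del: upt_Suc)

lemma measurable_map_upt:
  fixes f :: "nat \<Rightarrow> 'a \<Rightarrow> nat"
  assumes "\<And>i. f i \<in> measurable M (count_space UNIV)"
  shows "(\<lambda>x. map (\<lambda>i. f i x) [0..<m]) \<in> measurable M (count_space UNIV)"
proof (induction m)
  case (Suc m)
  have "(\<lambda>x. l @ [f m x]) \<in> measurable M (count_space UNIV)" for l
    by (rule measurable_compose[OF assms]) simp
  from measurable_compose_countable[OF this Suc.IH] show ?case by simp
qed simp

lemma chop_measurable: "chop k n \<in> measurable borel (count_space UNIV)"
  unfolding chop_def by measurable

lemma stick_left_measurable:
  assumes "\<And>i. (\<lambda>x. u x i) \<in> borel_measurable M"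
  shows "(\<lambda>x. stick_left k n (u x) i) \<in> measurable M (count_space UNIV)"
proof (induction i)
  case (Suc i)
  have "(\<lambda>x. chop k l (u x i)) \<in> measurable M (count_space UNIV)" for l
    by (rule measurable_compose[OF assms chop_measurable])
  from measurable_compose_countable[OF this Suc.IH] show ?case by simp
qed simp

lemma measure_floor_uniform:
  assumes "i < (m :: nat)"
  shows "measure (uniform_measure lborel {0<..<1 :: real}) {u. nat \<lfloor>real m * (1 - u)\<rfloor> = i} = 1 / real m"
proof -
  have m: "real m > 0" using assms by simp
  have B: "{u :: real. nat \<lfloor>real m * (1 - u)\<rfloor> = i} \<in> sets borel" by measurable
  have iff: "nat \<lfloor>real m * (1 - u)\<rfloor> = i \<longleftrightarrow> 1 - (real i + 1) / real m < u \<and> u \<le> 1 - real i / real m"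
    if "u < 1" for u
  proof -
    have "0 \<le> \<lfloor>real m * (1 - u)\<rfloor>" using that m by simp
    then have "nat \<lfloor>real m * (1 - u)\<rfloor> = i \<longleftrightarrow> \<lfloor>real m * (1 - u)\<rfloor> = int i" by linarith
    also have "\<dots> \<longleftrightarrow> real i \<le> real m * (1 - u) \<and> real m * (1 - u) < real i + 1"
      by (simp add: floor_eq_iff)
    also have "\<dots> \<longleftrightarrow> 1 - (real i + 1) / real m < u \<and> u \<le> 1 - real i / real m"
      using m by (auto simp: field_simps)
    finally show ?thesis .
  qed
  define a b where "a = 1 - (real i + 1) / real m" and "b = 1 - real i / real m"
  have "0 \<le> a" using assms m by (simp add: a_def field_simps)
  have "b - a = 1 / real m" "a \<le> b"
    using m by (simp_all add: a_def b_def field_simps)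
  define S where "S = {u. nat \<lfloor>real m * (1 - u)\<rfloor> = i}"
  have S: "u \<in> S \<longleftrightarrow> a < u \<and> u \<le> b" if "u < 1" for u
    using iff[OF that] by (simp add: S_def a_def b_def)
  have "measure lborel ({0<..<1} \<inter> S) = b - a"
  proof (cases "b = 1")
    case True
    then have "{0<..<1} \<inter> S = {a<..<1}"
      using S \<open>0 \<le> a\<close> by fastforce
    then show ?thesis using True \<open>a \<le> b\<close> by simp
  next
    case False
    moreover have "b \<le> 1" by (simp add: b_def)
    ultimately have "b < 1" by simp
    have "u \<in> {0<..<1} \<inter> S \<longleftrightarrow> u \<in> {a<..b}" for u
      using S[of u] \<open>0 \<le> a\<close> \<open>b < 1\<close> by (cases "u < 1") auto
    then have "{0<..<1} \<inter> S = {a<..b}" by blast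
    then show ?thesis using \<open>a \<le> b\<close> by simp
  qed
  then show ?thesis using B \<open>b - a = _\<close> by (simp add: S_def)
qed

locale iid_uniform = prob_space P for P :: "'b measure" +
  fixes U :: "nat \<Rightarrow> 'b \<Rightarrow> real"
  assumes indep: "indep_vars (\<lambda>_. borel) U UNIV"
    and uniform: "\<And>i. distr P borel (U i) = uniform_measure lborel {0<..<1}"
begin

lemma U_measurable [measurable]: "U i \<in> borel_measurable P"
  using indep by (auto simp: indep_vars_def)

lemma AE_U: "AE \<omega> in P. \<forall>i. 0 < U i \<omega> \<and> U i \<omega> < 1"
proof (subst AE_all_countable, rule allI)
  fix i
  have "AE u in distr P borel (U i). 0 < u \<and> u < 1"
    unfolding uniform by (rule AE_uniform_measureI) auto
  then show "AE \<omega> in P. 0 < U i \<omega> \<and> U i \<omega> < 1"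
    by (subst (asm) AE_distr_iff) auto
qed

lemma prob_floor:
  assumes "i < m"
  shows "prob (U s -` {u. nat \<lfloor>real m * (1 - u)\<rfloor> = i} \<inter> space P) = 1 / real m"
proof -
  have "prob (U s -` {u. nat \<lfloor>real m * (1 - u)\<rfloor> = i} \<inter> space P) =
      measure (distr P borel (U s)) {u. nat \<lfloor>real m * (1 - u)\<rfloor> = i}"
    by (subst measure_distr) auto
  then show ?thesis using measure_floor_uniform[OF assms] by (simp add: uniform)
qed

text \<open>
  Each break uses a new uniform variable, independent of the later ones, and splits the remaining
  length with the same law as the removal of one block of marks. The shift \<open>s\<close> is needed for
  the induction.
\<close>

lemma expectation_stick:
  fixes h :: "nat list \<Rightarrow> real"
  assumes "k \<ge> 1" and bd: "\<And>l. \<bar>h l\<bar> \<le> C"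
  shows "(\<integral>\<omega>. h (map (stick_left k n (\<lambda>i. U (s + i) \<omega>)) [0..<m]) \<partial>P) =
    mark_mean k n (\<lambda>bs. h (map (remaining bs) [0..<m]))"
  using bd
proof (induction m arbitrary: n s h)
  case 0
  then show ?case by (simp add: mark_mean_const prob_space)
next
  case (Suc m)
  \<comment> \<open>\<open>B i\<close> is the event that the stick breaks at \<open>i - k\<close>; it concerns only the variable with index \<open>s\<close>.\<close>
  define B where "B i = {u :: real. nat \<lfloor>real (n + k) * (1 - u)\<rfloor> = i}" for i
  define G where "G i v = h (n # map (stick_left k (i - k) (\<lambda>j. v (Suc s + j))) [0..<m])" for i v
  have Bm: "B i \<in> sets borel" for i unfolding B_def by measurable
  have "0 \<le> C" using Suc.prems[of "[]"] by linarith
  have Gbd: "\<bar>G i v\<bar> \<le> C" for i v using Suc.prems by (simp add: G_def)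
  have Gm: "G i \<in> borel_measurable (PiM {Suc s..} (\<lambda>_. borel))" for i
  proof -
    have "(\<lambda>v. v (Suc s + j)) \<in> borel_measurable (PiM {Suc s..} (\<lambda>_. borel :: real measure))" for j
      by (rule measurable_component_singleton) simp
    from measurable_map_upt[OF stick_left_measurable[OF this]]
    have "(\<lambda>v. map (stick_left k (i - k) (\<lambda>j. v (Suc s + j))) [0..<m]) \<in>
        measurable (PiM {Suc s..} (\<lambda>_. borel :: real measure)) (count_space UNIV)" .
    from measurable_compose[OF this, of "\<lambda>l. h (n # l)" borel] show ?thesis
      by (simp add: G_def[abs_def])
  qed
  have Gr: "G i (restrict (\<lambda>j. U j \<omega>) {Suc s..}) = G i (\<lambda>j. U j \<omega>)" for i \<omega>
    by (simp add: G_def)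
  have GU: "(\<lambda>\<omega>. G i (\<lambda>j. U j \<omega>)) \<in> borel_measurable P" for i
  proof -
    have "(\<lambda>\<omega>. restrict (\<lambda>j. U j \<omega>) {Suc s..}) \<in> measurable P (PiM {Suc s..} (\<lambda>_. borel))"
      by (intro measurable_restrict) simp
    from measurable_compose[OF this Gm[of i]] show ?thesis by (simp add: Gr)
  qed
  have IU: "(\<lambda>\<omega>. indicator (B i) (U s \<omega>) :: real) \<in> borel_measurable P" for i
    using Bm by (intro measurable_compose[OF U_measurable]) simp
  have prod: "(\<integral>\<omega>. indicator (B i) (U s \<omega>) * G i (\<lambda>j. U j \<omega>) \<partial>P) =
      1 / real (n + k) * mark_mean k (i - k) (\<lambda>bs. h (n # map (remaining bs) [0..<m]))"
    if "i < n + k" for i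
  proof -
    have "(\<integral>\<omega>. indicator (B i) (U s \<omega>) * G i (\<lambda>j. U j \<omega>) \<partial>P) =
        prob (U s -` B i \<inter> space P) * (\<integral>\<omega>. G i (\<lambda>j. U j \<omega>) \<partial>P)"
      using indep_vars_split_integral[OF indep, of s "{Suc s..}" "B i" "G i" C] Gm Gbd Bm
      unfolding Gr by auto
    moreover have "prob (U s -` B i \<inter> space P) = 1 / real (n + k)"
      unfolding B_def by (rule prob_floor[OF that])
    moreover have "(\<integral>\<omega>. G i (\<lambda>j. U j \<omega>) \<partial>P) =
        mark_mean k (i - k) (\<lambda>bs. h (n # map (remaining bs) [0..<m]))"
      unfolding G_def by (rule Suc.IH) (rule Suc.prems)
    ultimately show ?thesis by simp
  qed
  have "(\<integral>\<omega>. h (map (stick_left k n (\<lambda>i. U (s + i) \<omega>)) [0..<Suc m]) \<partial>P) =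
      (\<integral>\<omega>. (\<Sum>i<n + k. indicator (B i) (U s \<omega>) * G i (\<lambda>j. U j \<omega>)) \<partial>P)"
  proof (rule integral_cong_AE)
    show "AE \<omega> in P. h (map (stick_left k n (\<lambda>i. U (s + i) \<omega>)) [0..<Suc m]) =
        (\<Sum>i<n + k. indicator (B i) (U s \<omega>) * G i (\<lambda>j. U j \<omega>))"
      using AE_U
    proof eventually_elim
      case (elim \<omega>)
      define y where "y = real (n + k) * (1 - U s \<omega>)"
      define i0 where "i0 = nat \<lfloor>y\<rfloor>"
      have "y < real (n + k) * 1"
        unfolding y_def using elim assms(1) by (intro mult_strict_left_mono) auto
      moreover have "0 \<le> y"
        unfolding y_def using elim[rule_format, of s] by (intro mult_nonneg_nonneg) auto
      ultimately have "i0 < n + k" unfolding i0_def 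
        by (simp add: nat_less_iff floor_less_iff)
      have "(\<Sum>i<n + k. indicator (B i) (U s \<omega>) * G i (\<lambda>j. U j \<omega>)) =
          (\<Sum>i<n + k. if i = i0 then G i (\<lambda>j. U j \<omega>) else 0)"
        by (intro sum.cong) (auto simp: B_def i0_def y_def)
      also have "\<dots> = G i0 (\<lambda>j. U j \<omega>)"
        using \<open>i0 < n + k\<close> by (subst sum.delta) auto
      also have "\<dots> = h (map (stick_left k n (\<lambda>i. U (s + i) \<omega>)) [0..<Suc m])"
        unfolding map_upt_Suc_shift stick_left_Suc by (simp add: G_def chop_def i0_def y_def)
      finally show ?case ..
    qed
    have "(\<lambda>\<omega>. map (stick_left k n (\<lambda>i. U (s + i) \<omega>)) [0..<Suc m]) \<in> measurable P (count_space UNIV)"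
      by (intro measurable_map_upt stick_left_measurable U_measurable)
    then show "(\<lambda>\<omega>. h (map (stick_left k n (\<lambda>i. U (s + i) \<omega>)) [0..<Suc m])) \<in> borel_measurable P"
      by (rule measurable_compose) simp
    show "(\<lambda>\<omega>. \<Sum>i<n + k. indicator (B i) (U s \<omega>) * G i (\<lambda>j. U j \<omega>)) \<in> borel_measurable P"
      by (intro borel_measurable_sum borel_measurable_times IU GU)
  qed
  also have "\<dots> = (\<Sum>i<n + k. \<integral>\<omega>. indicator (B i) (U s \<omega>) * G i (\<lambda>j. U j \<omega>) \<partial>P)"
  proof (rule Bochner_Integration.integral_sum)
    fix i
    have "(\<lambda>\<omega>. indicator (B i) (U s \<omega>) * G i (\<lambda>j. U j \<omega>)) \<in> borel_measurable P"
      by (intro borel_measurable_times IU GU)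
    then show "integrable P (\<lambda>\<omega>. indicator (B i) (U s \<omega>) * G i (\<lambda>j. U j \<omega>))"
      using Gbd \<open>0 \<le> C\<close>
      by (intro integrable_const_bound[where B = C]) (auto simp: abs_mult split: split_indicator)
  qed
  also have "\<dots> = 1 / real (n + k) *
      (\<Sum>i<n + k. mark_mean k (i - k) (\<lambda>bs. h (n # map (remaining bs) [0..<m])))"
    unfolding sum_distrib_left by (intro sum.cong prod) auto
  also have "\<dots> = mark_mean k n (\<lambda>bs. h (n # map (remaining (drop_block bs)) [0..<m]))"
    using mark_mean_drop_block[of n k "\<lambda>bs. h (n # map (remaining bs) [0..<m])"] assms(1)
    by (simp add: field_simps)
  also have "\<dots> = mark_mean k n (\<lambda>bs. h (map (remaining bs) [0..<Suc m]))"
    by (rule mark_mean_cong) (simp add: map_upt_Suc_shift remaining_Suc del: upt_Suc)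
  finally show ?case .
qed

end

text \<open>
  Rounding and the offset \<open>k\<close> change each break by at most \<open>k + 1\<close>, which is
  negligible relative to \<open>n\<close>.
\<close>

lemma stick_left_LIMSEQ:
  assumes "\<And>i. 0 < u i \<and> u i < 1"
  shows "(\<lambda>n. real (stick_left k n u i) / real n) \<longlonglongrightarrow> (\<Prod>j<i. 1 - u j)"
proof (induction i)
  case 0
  have "\<forall>\<^sub>F n in sequentially. real (stick_left k n u 0) / real n = 1"
    using eventually_gt_at_top[of 0] by eventually_elim simp
  then show ?case by (simp add: tendsto_eventually)
next
  case (Suc i)
  have "\<bar>real (chop k r v) - real r * (1 - v)\<bar> \<le> real (k + 1)" if "0 < v" "v < 1" for r v
  proof -
    define y where "y = real (r + k) * (1 - v)"
    have y: "y = real r * (1 - v) + real k * (1 - v)" by (simp add: y_def distrib_right)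
    have "0 \<le> real k * (1 - v)" "real k * (1 - v) \<le> real k"
      using that by (auto intro!: mult_nonneg_nonneg mult_left_le)
    moreover have "0 \<le> real r * (1 - v)" using that by simp
    ultimately show ?thesis
      unfolding chop_def y_def[symmetric] using y by linarith
  qed
  then have "\<bar>real (stick_left k n u (Suc i)) / real n - real (stick_left k n u i) / real n * (1 - u i)\<bar>
      \<le> real (k + 1) / real n" for n
    using assms[of i] by (simp add: abs_divide divide_right_mono flip: diff_divide_distrib)
  then have "(\<lambda>n. real (stick_left k n u (Suc i)) / real n - real (stick_left k n u i) / real n * (1 - u i)) \<longlonglongrightarrow> 0"
    by (intro Lim_null_comparison[OF _ lim_const_over_n[of "real (k + 1)"]] always_eventually) simp
  from tendsto_add[OF this tendsto_mult[OF Suc.IH tendsto_const[of "1 - u i"]]]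
  show ?case by simp
qed

section \<open>Convergence of the finite-dimensional distributions\<close>

lemma restricted_continuous:
  assumes "continuous_map (powertop_real J) euclideanreal f"
  shows "continuous_on UNIV (\<lambda>v. f (restrict v J))"
proof -
  have "continuous_map (powertop_real UNIV) (powertop_real J) (\<lambda>v. restrict v J)"
    by (auto simp: continuous_map_componentwise intro: continuous_map_product_projection)
  from continuous_map_compose[OF this assms]
  show ?thesis by (simp add: euclidean_product_topology comp_def)
qed

lemma tendsto_function:
  fixes v :: "nat \<Rightarrow> nat \<Rightarrow> real"
  assumes "\<And>i. (\<lambda>n. v n i) \<longlonglongrightarrow> w i"
  shows "v \<longlonglongrightarrow> w"
  using assms
  by (simp add: limitin_componentwise flip: limitin_canonical_iff euclidean_product_topology)

theorem mainTheorem3: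
  fixes k :: nat
    and M :: "nat \<Rightarrow> 'a measure" and X :: "nat \<Rightarrow> nat \<Rightarrow> 'a \<Rightarrow> nat"
    and P :: "'b measure" and U :: "nat \<Rightarrow> 'b \<Rightarrow> real"
  assumes "k \<ge> 1"
    and "\<And>N. N > k \<Longrightarrow> uniform_walk (M N) N (X N)"
    and "prob_space P"
    and "prob_space.indep_vars P (\<lambda>_. borel) U UNIV"
    and "\<And>i. distr P borel (U i) = uniform_measure lborel {0<..<1}"
  shows "fdd_converges M (\<lambda>N \<omega>. reversed_proportions k (\<lambda>t. X N t \<omega>))
           P (\<lambda>\<omega>. stick_breaking (\<lambda>i. U i \<omega>))"
  unfolding fdd_converges_def
proof (intro allI impI, elim conjE)
  fix J :: "nat set" and f :: "(nat \<Rightarrow> real) \<Rightarrow> real"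
  assume "finite J" and f: "continuous_map (powertop_real J) euclideanreal f"
    and "bounded (f ` topspace (powertop_real J))"
  then obtain B where B: "\<bar>f v\<bar> \<le> B" if "v \<in> topspace (powertop_real J)" for v
    by (auto simp: bounded_iff)
  obtain m where m: "J \<subseteq> {..<m}" using finite_nat_bounded[OF \<open>finite J\<close>] by blast
  \<comment> \<open>Working on the full sequence space gives Borel measurability from continuity.\<close>
  define H where "H v = f (restrict v J)" for v
  have H_bd: "\<bar>H v\<bar> \<le> B" for v unfolding H_def by (rule B) simp
  have H_cong: "H v = H w" if "\<And>i. i < m \<Longrightarrow> v i = w i" for v w
    unfolding H_def using m that by (intro arg_cong[where f = f] restrict_ext) auto
  have H_cont: "continuous_on UNIV H" unfolding H_def by (rule restricted_continuous[OF f])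
  have H_meas: "H \<in> borel_measurable borel"
    by (rule borel_measurable_continuous_onI[OF H_cont])
  interpret iid_uniform P U
    using assms(3-5) by (intro iid_uniform.intro iid_uniform_axioms.intro)
  define W where "W n \<omega> i = (real (stick_left k n (\<lambda>i. U i \<omega>) i) -
    real (stick_left k n (\<lambda>i. U i \<omega>) (Suc i))) / real n" for n \<omega> i
  define F where "F n = (\<integral>\<omega>. H (W n \<omega>) \<partial>P)" for n
  have W_meas: "(\<lambda>\<omega>. H (W n \<omega>)) \<in> borel_measurable P" for n
  proof -
    have "(\<lambda>\<omega>. real (stick_left k n (\<lambda>i. U i \<omega>) i)) \<in> borel_measurable P" for i
      by (rule measurable_compose[OF stick_left_measurable]) auto
    then have "(\<lambda>\<omega>. W n \<omega> i) \<in> borel_measurable P" for i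
      unfolding W_def by (intro borel_measurable_divide borel_measurable_diff borel_measurable_const)
    then show ?thesis
      by (intro measurable_compose[OF measurable_coordinatewise_then_product H_meas])
  qed
  have limit_meas: "(\<lambda>\<omega>. H (stick_breaking (\<lambda>i. U i \<omega>))) \<in> borel_measurable P"
    unfolding stick_breaking_def
    by (intro measurable_compose[OF measurable_coordinatewise_then_product H_meas]) measurable
  have F_lim: "F \<longlonglongrightarrow> (\<integral>\<omega>. H (stick_breaking (\<lambda>i. U i \<omega>)) \<partial>P)"
    unfolding F_def
  proof (rule integral_dominated_convergence[where w = "\<lambda>_. B"])
    show "AE \<omega> in P. (\<lambda>n. H (W n \<omega>)) \<longlonglongrightarrow> H (stick_breaking (\<lambda>i. U i \<omega>))"
      using AE_U
    proof eventually_elim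
      case (elim \<omega>)
      have "(\<lambda>n. W n \<omega> i) \<longlonglongrightarrow> stick_breaking (\<lambda>i. U i \<omega>) i" for i
        using tendsto_diff[OF stick_left_LIMSEQ[of "\<lambda>i. U i \<omega>" k i] stick_left_LIMSEQ[of "\<lambda>i. U i \<omega>" k "Suc i"]] elim
        by (simp add: W_def stick_breaking_def diff_divide_distrib algebra_simps)
      then have "(\<lambda>n. W n \<omega>) \<longlonglongrightarrow> stick_breaking (\<lambda>i. U i \<omega>)"
        by (rule tendsto_function)
      then show ?case by (rule continuous_on_tendsto_compose[OF H_cont]) auto
    qed
  qed (use W_meas limit_meas H_bd in auto)
  have F_eq: "F n = mark_mean k n (\<lambda>bs. H (proportions bs))" for n
  proof -
    define h where "h l = H (\<lambda>i. (real (l ! i) - real (l ! Suc i)) / real (l ! 0))" for l :: "nat list"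
    have "F n = (\<integral>\<omega>. h (map (stick_left k n (\<lambda>i. U (0 + i) \<omega>)) [0..<Suc m]) \<partial>P)"
      unfolding F_def h_def W_def
      by (intro Bochner_Integration.integral_cong refl H_cong) (simp add: nth_map_upt del: upt_Suc stick_left.simps(2))
    also have "\<dots> = mark_mean k n (\<lambda>bs. h (map (remaining bs) [0..<Suc m]))"
      by (rule expectation_stick[OF assms(1), of h B]) (simp add: h_def H_bd)
    also have "\<dots> = mark_mean k n (\<lambda>bs. H (proportions bs))"
      unfolding h_def proportions_def by (intro arg_cong[where f = "mark_mean k n"] ext H_cong)
        (simp add: nth_map_upt del: upt_Suc)
    finally show ?thesis .
  qed
  have walk_eq: "(\<integral>\<omega>. H (reversed_proportions k (\<lambda>t. X N t \<omega>)) \<partial>M N) =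
      (\<Sum>n=1..N - k. survival N k n * real (n + k) / real N * F n)" if "N > k" for N
  proof -
    interpret W: walk "M N" N k "X N"
      using assms(1,2) that by (auto simp: walk_def walk_axioms_def uniform_walk_def)
    show ?thesis unfolding F_eq by (rule W.expectation_final[OF H_bd])
  qed
  have "(\<lambda>N. \<integral>\<omega>. H (reversed_proportions k (\<lambda>t. X N t \<omega>)) \<partial>M N)
      \<longlonglongrightarrow> (\<integral>\<omega>. H (stick_breaking (\<lambda>i. U i \<omega>)) \<partial>P)"
    by (rule Lim_transform_eventually[OF survival_average_LIMSEQ[OF F_lim, of k]])
      (use eventually_gt_at_top[of k] in eventually_elim, simp add: walk_eq)
  then show "(\<lambda>N. LINT \<omega>|M N. f (restrict (reversed_proportions k (\<lambda>t. X N t \<omega>)) J))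
      \<longlonglongrightarrow> (LINT \<omega>|P. f (restrict (stick_breaking (\<lambda>i. U i \<omega>)) J))"
    unfolding H_def .
qed

end
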